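(* Let $\Gamma_A\subset\partial\Omega$ be the absorbing boundary, let $\Gamma_R=\partial\Omega\setminus\Gamma_A$, and let $G_I$ be the interior Neumann Green's function of the unit ball $\Omega\subset\mathbb{R}^3$ (all as described in the context). Let $\sigma:\Gamma_A\to\mathbb{R}$ be continuous and integrable and suppose that it satisfies the first-kind integral equation $$\int_{\Gamma_A} G_I(x,x')\,\sigma(x')\,dS(x') = 1\qquad\text{for all } x\in\Gamma_A .$$ Define $$v(x)=\int_{\Gamma_A} G_I(x,x')\,\sigma(x')\,dS(x'),\qquad I_\sigma:=\int_{\Gamma_A}\sigma\,dS .$$ Then $I_\sigma\neq 0$, and $v$ solves the mixed boundary value problem $$\begin{cases}\Delta v=0, & x\in\Omega,\\ v=1, & x\in\Gamma_A,\\ \dfrac{\partial v}{\partial n}=D, & x\in\Gamma_R \ \text{ (away from the interface } \partial\Gamma_A),\end{cases}$$ with $D=-I_\sigma$.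
   Context: $\Omega$ is the open unit ball centered at the origin in $\mathbb{R}^3$, $\partial\Omega$ is the unit sphere, $dS$ is surface measure on $\partial\Omega$, and $\partial/\partial n$ is the derivative in the direction of the normal pointing out of $\Omega$. Boundary values of $v$ and of $\partial v/\partial n$ are understood as limits from inside $\Omega$. The absorbing boundary $\Gamma_A$ is a union of $N\ge 1$ disk-shaped patches on $\partial\Omega$ (open geodesic disks), each of radius $\varepsilon>0$ measured in arc length along the sphere. The patches are well-separated: the arc-length distance along the sphere between the centers of any two distinct patches is at least $3\varepsilon$. The patches cover the sphere only partially (so $\partial\Omega\setminus\overline{\Gamma_A}\ne\emptyset$). The reflecting boundary is $\Gamma_R=\partial\Omega\setminus\Gamma_A$, and $\partial\Gamma_A$ denotes the union of the bounding circles of the patches. The interior Neumann Green's function of the unit ball with second argument on the boundary is, for $x\in\overline{\Omega}$, $x'\in\partial\Omega$, $x\neq x'$, $$G_I(x,x')=\frac{2}{|x-x'|}+\log\left(\frac{2}{1-x\cdot x'+|x-x'|}\right).$$ When also $x\in\partial\Omega$, this equals $$\frac{2}{|x-x'|}+\log\left(\frac{2}{|x-x'|}\right)-\log\left(1+\tfrac12|x-x'|\right).$$ *)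

theory Defs
  imports "HOL-Analysis.Analysis"
begin

text \<open>
  Surface measure on the unit sphere, as the measure \<open>dS\<close> for which
  \<open>dx = r\<^sup>2 dr dS\<close> in polar coordinates: the area of a part \<open>A\<close> of the sphere
  is three times the volume of the solid cone \<open>{t x | x \<in> A, 0 < t < 1}\<close>. It is a measure on
  the Borel sets of the whole space, concentrated on the sphere. (The map \<open>sgn\<close> sends
  \<open>x \<noteq> 0\<close> to \<open>x / |x|\<close>; the origin is a null set.)
\<close>

definition sphere_measure :: "(real^3) measure" where
  "sphere_measure = distr (density lborel (\<lambda>x. 3 * indicator (ball 0 1) x)) borel sgn"

lemma sgn_borel_measurable [measurable]: "sgn \<in> borel_measurable (borel :: (real^3) measure)"
  unfolding sgn_div_norm by measurable

lemma emeasure_sphere_measure: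
  assumes [measurable]: "A \<in> sets borel"
  shows "emeasure sphere_measure A = 3 * emeasure lborel {x \<in> ball 0 1. sgn x \<in> A}"
proof -
  have eq: "{x \<in> ball 0 1. sgn x \<in> A} = sgn -` A \<inter> ball 0 1"
    by auto
  have [measurable]: "sgn -` A \<in> sets (borel :: (real^3) measure)"
    using measurable_sets_borel[OF sgn_borel_measurable assms] by simp
  have "emeasure sphere_measure A =
      (\<integral>\<^sup>+x. 3 * indicator (ball 0 1) x * indicator (sgn -` A) x \<partial>lborel)"
    unfolding sphere_measure_def
    by (subst emeasure_distr, simp, simp, subst emeasure_density) (measurable, simp_all)
  also have "\<dots> = (\<integral>\<^sup>+x. 3 * indicator (sgn -` A \<inter> ball 0 1) x \<partial>lborel)"
    by (intro nn_integral_cong) (auto simp: indicator_def)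
  also have "\<dots> = 3 * emeasure lborel {x \<in> ball 0 1. sgn x \<in> A}"
    unfolding eq by (subst nn_integral_cmult_indicator) auto
  finally show ?thesis .
qed

lemma emeasure_sphere_measure_sphere: "emeasure sphere_measure (sphere 0 1) = ennreal (4 * pi)"
proof -
  have "emeasure sphere_measure (sphere 0 1) =
      3 * emeasure lborel {x \<in> ball 0 1. sgn x \<in> sphere (0 :: real^3) 1}"
    by (simp add: emeasure_sphere_measure)
  also have "{x \<in> ball 0 1. sgn x \<in> sphere (0 :: real^3) 1} = ball 0 1 - {0}"
    by (auto simp: norm_sgn)
  also have "emeasure lborel (ball 0 1 - {0 :: real^3}) = emeasure lborel (ball (0 :: real^3) 1)"
    by (subst emeasure_Diff) auto
  also have "\<dots> = ennreal (4 / 3 * pi)"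
    by (subst emeasure_ball) (auto simp: unit_ball_vol_3)
  also have "3 * ennreal (4 / 3 * pi) = ennreal (3 * (4 / 3 * pi))"
    by (subst ennreal_mult) auto
  finally show ?thesis by (simp add: ennreal_mult)
qed

definition arc_dist :: "real^3 \<Rightarrow> real^3 \<Rightarrow> real" where
  "arc_dist x y = arccos (x \<bullet> y)" \<comment> \<open>great-circle distance, for unit vectors \<open>x\<close>, \<open>y\<close>\<close>

definition geodesic_disk :: "real^3 \<Rightarrow> real \<Rightarrow> (real^3) set" where
  "geodesic_disk p r = {x \<in> sphere 0 1. arc_dist p x < r}"

definition geodesic_circle :: "real^3 \<Rightarrow> real \<Rightarrow> (real^3) set" where
  "geodesic_circle p r = {x \<in> sphere 0 1. arc_dist p x = r}"

text \<open>
  Meaningful for \<open>x'\<close> on the unit sphere and \<open>x \<noteq> x'\<close> in the closed ball. Its value on the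
  diagonal is immaterial: single points are null sets of the surface measure.
\<close>

definition neumann_green :: "real^3 \<Rightarrow> real^3 \<Rightarrow> real" where
  "neumann_green x x' =
     2 / norm (x - x') + ln (2 / (1 - x \<bullet> x' + norm (x - x')))"

definition single_layer :: "(real^3) set \<Rightarrow> (real^3 \<Rightarrow> real) \<Rightarrow> real^3 \<Rightarrow> real" where
  "single_layer \<Gamma> \<sigma> x = (LINT x':\<Gamma>|sphere_measure. neumann_green x x' * \<sigma> x')"

definition dir_deriv :: "'a::real_normed_vector \<Rightarrow> ('a \<Rightarrow> real) \<Rightarrow> 'a \<Rightarrow> real" where
  "dir_deriv u f x = frechet_derivative f (at x) u"

definition C2_on :: "('a::euclidean_space \<Rightarrow> real) \<Rightarrow> 'a set \<Rightarrow> bool" where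
  "C2_on f S \<longleftrightarrow>
     (\<forall>x\<in>S. f differentiable (at x)) \<and>
     (\<forall>u\<in>Basis. \<forall>x\<in>S. dir_deriv u f differentiable (at x)) \<and>
     (\<forall>u\<in>Basis. \<forall>w\<in>Basis. continuous_on S (dir_deriv w (dir_deriv u f)))"

definition laplacian :: "('a::euclidean_space \<Rightarrow> real) \<Rightarrow> 'a \<Rightarrow> real" where
  "laplacian f x = (\<Sum>u\<in>Basis. dir_deriv u (dir_deriv u f) x)"

text \<open>
  Boundary data are limits from inside the unit ball. The outward unit normal at a point \<open>x\<close>
  of the unit sphere is \<open>x\<close> itself.
\<close>

definition has_boundary_value :: "(real^3 \<Rightarrow> real) \<Rightarrow> real \<Rightarrow> real^3 \<Rightarrow> bool" where
  "has_boundary_value v L x \<longleftrightarrow> (v \<longlongrightarrow> L) (at x within ball 0 1)"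

definition has_normal_derivative :: "(real^3 \<Rightarrow> real) \<Rightarrow> real \<Rightarrow> real^3 \<Rightarrow> bool" where
  "has_normal_derivative v D x \<longleftrightarrow> (dir_deriv x v \<longlongrightarrow> D) (at x within ball 0 1)"

end

theory Submission
  imports Defs
begin

text \<open>
  Write \<open>U \<rho>\<close> for the potential \<open>\<integral> G(x, y) \<rho>(y) dS(y)\<close> of a charge density on the sphere, so that
  \<open>v = U \<rho>\<close> with \<open>\<rho> = \<sigma>\<close> on the patches and \<open>\<rho> = 0\<close> elsewhere. Everything rests on two facts about
  the kernel. With \<open>y\<close> on the sphere, \<open>G(x, y)\<close> is a combination of \<open>1/|x - y|\<close> and of the logarithm
  \<open>ln (|z| - z \<bullet> y)\<close> at \<open>z = x - y\<close>, both harmonic in \<open>x\<close>. And its radial derivative is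
  \<open>4 \<pi>\<close> times the Poisson kernel minus one (\<open>green_grad_radial\<close>):
  \<open>x \<bullet> \<nabla>G(x, y) = (1 - |x|\<^sup>2) / |x - y|\<^sup>3 - 1\<close> on the closed ball without \<open>y\<close>.

  The differential equation follows by differentiating under the integral sign, uniformly over the
  compact sphere (\<open>harmonic_green_potential\<close>). At a boundary point away from the charge the
  gradient extends continuously, and there the radial identity reads \<open>-1\<close>, so that the normal
  derivative is minus the total charge. At a point of the absorbing set the density is locally
  bounded; since \<open>0 \<le> G \<le> 4/|x - y|\<close> and a ball of radius \<open>t\<close> carries surface measure \<open>O(t\<^sup>2)\<close>,
  the nearby charge contributes uniformly little, and \<open>U \<rho>\<close> is continuous up to the boundary
  there (\<open>green_potential_locally_bounded\<close>).

  The remaining assertion \<open>I\<^sub>\<sigma> \<noteq> 0\<close> is a uniqueness statement. Integrating by parts would need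
  finite energy, which an integrable density may fail to have, so it is derived from a domination
  principle. Suppose the total charge vanishes. Cut the negative part of \<open>\<rho>\<close> down to a compact part
  \<open>K\<close> of the absorbing set, and restore neutrality by adding a small bounded negative charge on
  \<open>K\<close>. The new charge \<open>\<mu>\<close> is neutral, nonnegative off \<open>K\<close>, and \<open>U \<mu> \<ge> 1/2\<close> on \<open>K\<close>. By the radial
  identity, off \<open>K\<close> its potential has radial derivative bounded below by a term vanishing on the
  sphere, and a Hopf argument shows that such a function cannot have its infimum outside \<open>K\<close>
  (\<open>neumann_minimum_principle\<close>). Hence \<open>U \<mu> > 0\<close> in the ball; but \<open>G(0, y) = 2\<close>, so \<open>U \<mu>\<close> at the
  centre is twice the total charge, which is zero.
\<close>

section \<open>Integrals depending on a parameter\<close>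

lemma continuous_on_section:
  assumes "continuous_on (A \<times> K) (\<lambda>(x, y). F x y)" and "x \<in> A"
  shows "continuous_on K (F x)"
  using continuous_on_compose2[OF assms(1) continuous_on_Pair[OF continuous_on_const continuous_on_id]]
    assms(2) by auto

lemma integrable_scaleR_continuous_on:
  fixes F :: "'b::euclidean_space \<Rightarrow> 'c::euclidean_space" and \<rho> :: "'b \<Rightarrow> real"
  assumes M: "sets M = sets borel" and K: "compact K" and \<rho>: "integrable M \<rho>"
    and supp: "\<And>y. y \<notin> K \<Longrightarrow> \<rho> y = 0" and F: "continuous_on K F"
  shows "integrable M (\<lambda>y. \<rho> y *\<^sub>R F y)"
proof -
  obtain B where B: "\<And>y. y \<in> K \<Longrightarrow> norm (F y) \<le> B"
    using compact_imp_bounded[OF compact_continuous_image[OF F K]] unfolding bounded_iff by auto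
  have "(\<lambda>y. indicator K y *\<^sub>R F y) \<in> borel_measurable borel"
    using borel_measurable_continuous_on_indicator[OF _ F] K by (simp add: compact_imp_closed)
  then have "(\<lambda>y. indicator K y *\<^sub>R F y) \<in> borel_measurable M"
    using M measurable_cong_sets by blast
  then have "(\<lambda>y. \<rho> y *\<^sub>R (indicator K y *\<^sub>R F y)) \<in> borel_measurable M"
    by (rule borel_measurable_scaleR[OF borel_measurable_integrable[OF \<rho>]])
  moreover have eq: "(\<lambda>y. \<rho> y *\<^sub>R (indicator K y *\<^sub>R F y)) = (\<lambda>y. \<rho> y *\<^sub>R F y)"
    using supp by (auto simp: indicator_def fun_eq_iff)
  ultimately have meas: "(\<lambda>y. \<rho> y *\<^sub>R F y) \<in> borel_measurable M" by simp
  show ?thesis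
  proof (rule Bochner_Integration.integrable_bound[OF integrable_mult_right[OF \<rho>, of B] meas])
    have "norm (\<rho> y *\<^sub>R F y) \<le> norm (B * \<rho> y)" for y
    proof (cases "y \<in> K")
      case True
      then have "norm (F y) \<le> \<bar>B\<bar>" using B[OF True] by simp
      then show ?thesis
      using mult_left_mono[OF _ abs_ge_zero[of "\<rho> y"], of "norm (F y)" "\<bar>B\<bar>"]
      by (simp add: abs_mult mult.commute[of "\<bar>B\<bar>"])
    qed (use supp in auto)
    then show "AE y in M. norm (\<rho> y *\<^sub>R F y) \<le> norm (B * \<rho> y)" by simp
  qed
qed

lemma norm_integral_scaleR_le:
  fixes F :: "'b::euclidean_space \<Rightarrow> 'c::euclidean_space" and \<rho> :: "'b \<Rightarrow> real"
  assumes \<rho>: "integrable M \<rho>"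
    and supp: "\<And>y. y \<notin> K \<Longrightarrow> \<rho> y = 0" and le: "\<And>y. y \<in> K \<Longrightarrow> norm (F y) \<le> B"
  shows "norm (\<integral>y. \<rho> y *\<^sub>R F y \<partial>M) \<le> B * (\<integral>y. \<bar>\<rho> y\<bar> \<partial>M)"
proof (cases "integrable M (\<lambda>y. \<rho> y *\<^sub>R F y)")
  case True
  have "norm (\<integral>y. \<rho> y *\<^sub>R F y \<partial>M) \<le> (\<integral>y. norm (\<rho> y *\<^sub>R F y) \<partial>M)"
    by (rule integral_norm_bound)
  also have "\<dots> \<le> (\<integral>y. B * \<bar>\<rho> y\<bar> \<partial>M)"
  proof (rule integral_mono)
    show "norm (\<rho> y *\<^sub>R F y) \<le> B * \<bar>\<rho> y\<bar>" for y
      using mult_left_mono[OF le[of y] abs_ge_zero[of "\<rho> y"]] supp[of y]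
      by (cases "y \<in> K") (auto simp: mult.commute)
  qed (use integrable_norm[OF True] \<rho> in auto)
  finally show ?thesis by simp
next
  case False
  then have "norm (\<integral>y. \<rho> y *\<^sub>R F y \<partial>M) = 0" by (simp add: not_integrable_integral_eq)
  moreover have "0 \<le> B * (\<integral>y. \<bar>\<rho> y\<bar> \<partial>M)"
  proof (cases "\<exists>y. y \<in> K")
    case True
    then obtain y where "y \<in> K" by auto
    from le[OF this] have "0 \<le> B" using norm_ge_zero order_trans by blast
    then show ?thesis by (simp add: integral_nonneg_AE)
  next
    case False
    then have "\<rho> y = 0" for y using supp by blast
    then show ?thesis by simp
  qed
  ultimately show ?thesis by simp
qed

lemma continuous_on_kernel_integral:
  fixes F :: "'a::metric_space \<Rightarrow> 'b::euclidean_space \<Rightarrow> 'c::euclidean_space" and \<rho> :: "'b \<Rightarrow> real"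
  assumes M: "sets M = sets borel" and K: "compact K" and \<rho>: "integrable M \<rho>"
    and supp: "\<And>y. y \<notin> K \<Longrightarrow> \<rho> y = 0"
    and F: "continuous_on (A \<times> K) (\<lambda>(x, y). F x y)"
  shows "continuous_on A (\<lambda>x. \<integral>y. \<rho> y *\<^sub>R F x y \<partial>M)"
  unfolding continuous_on_def
proof
  fix x0 assume x0: "x0 \<in> A"
  have cF: "continuous_on K (F x)" if "x \<in> A" for x
    by (rule continuous_on_section[OF F that])
  note int = integrable_scaleR_continuous_on[OF M K \<rho> supp cF]
  let ?Q = "\<integral>y. \<bar>\<rho> y\<bar> \<partial>M"
  have Q: "?Q \<ge> 0" by simp
  show "((\<lambda>x. \<integral>y. \<rho> y *\<^sub>R F x y \<partial>M) \<longlongrightarrow> (\<integral>y. \<rho> y *\<^sub>R F x0 y \<partial>M)) (at x0 within A)"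
  proof (rule tendstoI)
    fix e :: real assume e: "e > 0"
    define e' where "e' = e / (?Q + 1)"
    have e': "e' > 0" unfolding e'_def using e Q by (simp add: add_nonneg_pos)
    have "e' * ?Q < e' * (?Q + 1)" using e' by simp
    also have "\<dots> = e" unfolding e'_def using Q by (simp add: add_nonneg_eq_0_iff)
    finally have lt: "e' * ?Q < e" .
    from continuous_on_prod_compactE[OF F K x0 e'] obtain X where X: "x0 \<in> X" "open X"
      and le: "\<forall>x\<in>X \<inter> A. \<forall>t\<in>K. dist ((\<lambda>(x, y). F x y) (x, t)) ((\<lambda>(x, y). F x y) (x0, t)) \<le> e'"
      by metis
    have "\<forall>\<^sub>F x in at x0 within A. x \<in> X \<inter> A"
      unfolding eventually_at_topological using X by auto
    then show "\<forall>\<^sub>F x in at x0 within A.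
        dist (\<integral>y. \<rho> y *\<^sub>R F x y \<partial>M) (\<integral>y. \<rho> y *\<^sub>R F x0 y \<partial>M) < e"
    proof eventually_elim
      case (elim x)
      then have x: "x \<in> A" by simp
      have "dist (\<integral>y. \<rho> y *\<^sub>R F x y \<partial>M) (\<integral>y. \<rho> y *\<^sub>R F x0 y \<partial>M)
          = norm (\<integral>y. \<rho> y *\<^sub>R (F x y - F x0 y) \<partial>M)"
        unfolding dist_norm scaleR_diff_right
        by (subst Bochner_Integration.integral_diff[OF int int]) (use x x0 in auto)
      also have "\<dots> \<le> e' * ?Q"
        using le elim by (intro norm_integral_scaleR_le[OF \<rho> supp]) (auto simp: dist_norm)
      finally show ?case using lt by linarith
    qed
  qed
qed

text \<open>
  Joint continuity of the gradient on a neighbourhood times a compact set makes the linearisation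
  error of the kernel \<open>o(|z - x|)\<close> uniformly in \<open>y\<close>, and this survives integration against \<open>\<rho>\<close>.
\<close>
lemma has_derivative_kernel_integral:
  fixes F :: "'a::euclidean_space \<Rightarrow> 'b::euclidean_space \<Rightarrow> real" and \<rho> :: "'b \<Rightarrow> real"
  assumes M: "sets M = sets borel" and K: "compact K" and \<rho>: "integrable M \<rho>"
    and supp: "\<And>y. y \<notin> K \<Longrightarrow> \<rho> y = 0" and S: "open S" "x \<in> S"
    and F: "\<And>x. x \<in> S \<Longrightarrow> continuous_on K (F x)"
    and der: "\<And>x y. x \<in> S \<Longrightarrow> y \<in> K \<Longrightarrow> ((\<lambda>x. F x y) has_derivative (\<lambda>u. F' x y \<bullet> u)) (at x)"
    and F': "continuous_on (S \<times> K) (\<lambda>(x, y). F' x y)"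
  shows "((\<lambda>x. \<integral>y. \<rho> y * F x y \<partial>M) has_derivative
           (\<lambda>u. (\<integral>y. \<rho> y *\<^sub>R F' x y \<partial>M) \<bullet> u)) (at x)"
  unfolding has_derivative_at_alt
proof (intro conjI allI impI)
  show "bounded_linear (\<lambda>u. (\<integral>y. \<rho> y *\<^sub>R F' x y \<partial>M) \<bullet> u)"
    by (rule bounded_linear_inner_right)
next
  fix e :: real assume e: "e > 0"
  have "continuous_on K (F' x)" by (rule continuous_on_section[OF F' S(2)])
  note int' = integrable_scaleR_continuous_on[OF M K \<rho> supp this]
  have int: "integrable M (\<lambda>y. \<rho> y * F z y)" if "z \<in> S" for z
    using integrable_scaleR_continuous_on[OF M K \<rho> supp F[OF that]] by simp
  let ?Q = "\<integral>y. \<bar>\<rho> y\<bar> \<partial>M"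
  have Q: "?Q \<ge> 0" by simp
  define e' where "e' = e / (?Q + 1)"
  have e': "e' > 0" unfolding e'_def using e Q by (simp add: add_nonneg_pos)
  have "e' * ?Q \<le> e' * (?Q + 1)" using e' by simp
  also have "\<dots> = e" unfolding e'_def using Q by (simp add: add_nonneg_eq_0_iff)
  finally have lt: "e' * ?Q \<le> e" .
  from continuous_on_prod_compactE[OF F' K S(2) e'] obtain X where X: "x \<in> X" "open X"
    and le: "\<forall>z\<in>X \<inter> S. \<forall>t\<in>K. dist ((\<lambda>(x, y). F' x y) (z, t)) ((\<lambda>(x, y). F' x y) (x, t)) \<le> e'"
    by metis
  obtain d where d: "d > 0" "ball x d \<subseteq> X \<inter> S"
    using X S open_contains_ball[of "X \<inter> S"] by (metis IntI open_Int)
  show "\<exists>d>0. \<forall>z. norm (z - x) < d \<longrightarrow>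
      norm ((\<integral>y. \<rho> y * F z y \<partial>M) - (\<integral>y. \<rho> y * F x y \<partial>M)
        - (\<integral>y. \<rho> y *\<^sub>R F' x y \<partial>M) \<bullet> (z - x)) \<le> e * norm (z - x)"
  proof (intro exI[of _ d] conjI allI impI d)
    fix z assume "norm (z - x) < d"
    then have z: "z \<in> ball x d" by (simp add: dist_norm norm_minus_commute)
    have R: "norm (F z y - F x y - F' x y \<bullet> (z - x)) \<le> e' * norm (z - x)" if y: "y \<in> K" for y
    proof -
      have "norm (F z y - F x y - F' x y \<bullet> (z - x)) \<le> norm (z - x) * e'"
      proof (rule differentiable_bound_linearization
            [where S = "ball x d" and f = "\<lambda>x. F x y" and f' = "\<lambda>w u. F' w y \<bullet> u" and ?x0.0 = x])
        fix t :: real assume t: "t \<in> {0..1}"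
        have "dist x (x + t *\<^sub>R (z - x)) = t * dist x z"
          using t by (simp add: dist_norm norm_minus_commute)
        also have "\<dots> \<le> 1 * dist x z" using t by (intro mult_right_mono) auto
        also have "\<dots> < d" using z by simp
        finally show "x + t *\<^sub>R (z - x) \<in> ball x d" by simp
      next
        fix w assume "w \<in> ball x d"
        then have "w \<in> S" using d by blast
        show "((\<lambda>x. F x y) has_derivative (\<lambda>u. F' w y \<bullet> u)) (at w within ball x d)"
          by (rule has_derivative_at_withinI[OF der[OF \<open>w \<in> S\<close> y]])
      next
        fix w assume w: "w \<in> ball x d"
        have "w \<in> X \<inter> S" using w d by blast
        then have n: "norm (F' w y - F' x y) \<le> e'" using le y by (auto simp: dist_norm)
        show "onorm ((\<lambda>u. F' w y \<bullet> u) - (\<lambda>u. F' x y \<bullet> u)) \<le> e'"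
        proof (rule onorm_bound)
          show "0 \<le> e'" using e' by simp
          fix u
          have "norm ((F' w y - F' x y) \<bullet> u) \<le> norm (F' w y - F' x y) * norm u"
            by (simp add: Cauchy_Schwarz_ineq2)
          also have "\<dots> \<le> e' * norm u" using n by (intro mult_right_mono) auto
          finally show "norm (((\<lambda>u. F' w y \<bullet> u) - (\<lambda>u. F' x y \<bullet> u)) u) \<le> e' * norm u"
            by (simp add: inner_diff_left)
        qed
      qed (use d in auto)
      then show ?thesis by (simp add: mult.commute)
    qed
    have zS: "z \<in> S" using z d by auto
    have "(\<integral>y. \<rho> y *\<^sub>R F' x y \<partial>M) \<bullet> (z - x) = (\<integral>y. (\<rho> y *\<^sub>R F' x y) \<bullet> (z - x) \<partial>M)"
      using int' by (subst integral_inner_left) auto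
    moreover have "integrable M (\<lambda>y. (\<rho> y *\<^sub>R F' x y) \<bullet> (z - x))"
      using int' by (intro integrable_inner_left) auto
    moreover have "(\<lambda>y. \<rho> y *\<^sub>R (F z y - F x y - F' x y \<bullet> (z - x)))
        = (\<lambda>y. \<rho> y * F z y - \<rho> y * F x y - (\<rho> y *\<^sub>R F' x y) \<bullet> (z - x))"
      by (auto simp: algebra_simps)
    ultimately have "(\<integral>y. \<rho> y * F z y \<partial>M) - (\<integral>y. \<rho> y * F x y \<partial>M)
        - (\<integral>y. \<rho> y *\<^sub>R F' x y \<partial>M) \<bullet> (z - x)
        = (\<integral>y. \<rho> y *\<^sub>R (F z y - F x y - F' x y \<bullet> (z - x)) \<partial>M)"
      using int[OF zS] int[OF S(2)] by (simp del: inner_scaleR_left)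
    also have "norm \<dots> \<le> (e' * norm (z - x)) * ?Q"
      by (rule norm_integral_scaleR_le[OF \<rho> supp R])
    also have "\<dots> \<le> e * norm (z - x)"
      using mult_right_mono[OF lt norm_ge_zero[of "z - x"]] by (simp add: mult_ac)
    finally show "norm ((\<integral>y. \<rho> y * F z y \<partial>M) - (\<integral>y. \<rho> y * F x y \<partial>M)
        - (\<integral>y. \<rho> y *\<^sub>R F' x y \<partial>M) \<bullet> (z - x)) \<le> e * norm (z - x)" .
  qed
qed

section \<open>Harmonic functions and the minimum principle\<close>

text \<open>
  The gradient is a separate argument because radial derivatives and boundary limits are later
  read off from it. \<open>H u\<close> is the gradient of the component of \<open>g\<close> in direction \<open>u\<close>, that is, a row
  of the Hessian, and the last condition says that the Hessian has trace zero.
\<close>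
definition harmonic_with_gradient ::
  "('a::euclidean_space \<Rightarrow> real) \<Rightarrow> ('a \<Rightarrow> 'a) \<Rightarrow> 'a set \<Rightarrow> bool" where
  "harmonic_with_gradient f g S \<longleftrightarrow>
     (\<forall>x\<in>S. (f has_derivative (\<lambda>u. g x \<bullet> u)) (at x)) \<and>
     (\<exists>H. (\<forall>u\<in>Basis. \<forall>x\<in>S. ((\<lambda>y. g y \<bullet> u) has_derivative (\<lambda>w. H u x \<bullet> w)) (at x)) \<and>
          (\<forall>u\<in>Basis. continuous_on S (H u)) \<and>
          (\<forall>x\<in>S. (\<Sum>u\<in>Basis. H u x \<bullet> u) = 0))"

lemma harmonic_with_gradientI:
  assumes "\<And>x. x \<in> S \<Longrightarrow> (f has_derivative (\<lambda>u. g x \<bullet> u)) (at x)"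
    and "\<And>x u. x \<in> S \<Longrightarrow> u \<in> Basis \<Longrightarrow> ((\<lambda>y. g y \<bullet> u) has_derivative (\<lambda>w. H u x \<bullet> w)) (at x)"
    and "\<And>u. u \<in> Basis \<Longrightarrow> continuous_on S (H u)"
    and "\<And>x. x \<in> S \<Longrightarrow> (\<Sum>u\<in>Basis. H u x \<bullet> u) = 0"
  shows "harmonic_with_gradient f g S"
  unfolding harmonic_with_gradient_def using assms by blast

lemma harmonic_with_gradientE:
  assumes "harmonic_with_gradient f g S"
  obtains H where "\<And>x. x \<in> S \<Longrightarrow> (f has_derivative (\<lambda>u. g x \<bullet> u)) (at x)"
    and "\<And>x u. x \<in> S \<Longrightarrow> u \<in> Basis \<Longrightarrow> ((\<lambda>y. g y \<bullet> u) has_derivative (\<lambda>w. H u x \<bullet> w)) (at x)"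
    and "\<And>u. u \<in> Basis \<Longrightarrow> continuous_on S (H u)"
    and "\<And>x. x \<in> S \<Longrightarrow> (\<Sum>u\<in>Basis. H u x \<bullet> u) = 0"
  using assms unfolding harmonic_with_gradient_def by blast

lemma harmonic_with_gradient_has_derivative:
  "harmonic_with_gradient f g S \<Longrightarrow> x \<in> S \<Longrightarrow> (f has_derivative (\<lambda>u. g x \<bullet> u)) (at x)"
  unfolding harmonic_with_gradient_def by blast

lemma harmonic_with_gradient_continuous_on:
  "harmonic_with_gradient f g S \<Longrightarrow> continuous_on S f"
  by (intro continuous_at_imp_continuous_on ballI has_derivative_continuous)
    (rule harmonic_with_gradient_has_derivative)

lemma harmonic_with_gradient_subset:
  "harmonic_with_gradient f g S \<Longrightarrow> T \<subseteq> S \<Longrightarrow> harmonic_with_gradient f g T"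
  by (erule harmonic_with_gradientE, rule harmonic_with_gradientI)
    (blast intro: continuous_on_subset)+

lemma harmonic_with_gradient_const: "harmonic_with_gradient (\<lambda>x. k) (\<lambda>x. 0) S"
  by (rule harmonic_with_gradientI[where H = "\<lambda>u x. 0"]) auto

lemma harmonic_with_gradient_lincomb:
  assumes "harmonic_with_gradient f g S" "harmonic_with_gradient f' g' S"
  shows "harmonic_with_gradient (\<lambda>x. a * f x + b * f' x) (\<lambda>x. a *\<^sub>R g x + b *\<^sub>R g' x) S"
proof -
  obtain H where H: "\<And>x. x \<in> S \<Longrightarrow> (f has_derivative (\<lambda>u. g x \<bullet> u)) (at x)"
    "\<And>x u. x \<in> S \<Longrightarrow> u \<in> Basis \<Longrightarrow> ((\<lambda>y. g y \<bullet> u) has_derivative (\<lambda>w. H u x \<bullet> w)) (at x)"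
    "\<And>u. u \<in> Basis \<Longrightarrow> continuous_on S (H u)"
    "\<And>x. x \<in> S \<Longrightarrow> (\<Sum>u\<in>Basis. H u x \<bullet> u) = 0"
    by (rule harmonic_with_gradientE[OF assms(1)]) blast
  obtain H' where H': "\<And>x. x \<in> S \<Longrightarrow> (f' has_derivative (\<lambda>u. g' x \<bullet> u)) (at x)"
    "\<And>x u. x \<in> S \<Longrightarrow> u \<in> Basis \<Longrightarrow> ((\<lambda>y. g' y \<bullet> u) has_derivative (\<lambda>w. H' u x \<bullet> w)) (at x)"
    "\<And>u. u \<in> Basis \<Longrightarrow> continuous_on S (H' u)"
    "\<And>x. x \<in> S \<Longrightarrow> (\<Sum>u\<in>Basis. H' u x \<bullet> u) = 0"
    by (rule harmonic_with_gradientE[OF assms(2)]) blast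
  show ?thesis
  proof (rule harmonic_with_gradientI[where H = "\<lambda>u x. a *\<^sub>R H u x + b *\<^sub>R H' u x"])
    fix x assume x: "x \<in> S"
    show "((\<lambda>x. a * f x + b * f' x) has_derivative (\<lambda>u. (a *\<^sub>R g x + b *\<^sub>R g' x) \<bullet> u)) (at x)"
      using has_derivative_add[OF has_derivative_mult_right[OF H(1)[OF x]]
          has_derivative_mult_right[OF H'(1)[OF x]]] by (simp add: inner_add_left)
    have "(\<Sum>u\<in>Basis. (a *\<^sub>R H u x + b *\<^sub>R H' u x) \<bullet> u)
        = a * (\<Sum>u\<in>Basis. H u x \<bullet> u) + b * (\<Sum>u\<in>Basis. H' u x \<bullet> u)"
      by (simp add: inner_add_left sum.distrib sum_distrib_left)
    then show "(\<Sum>u\<in>Basis. (a *\<^sub>R H u x + b *\<^sub>R H' u x) \<bullet> u) = 0"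
      using H(4)[OF x] H'(4)[OF x] by simp
    fix u :: 'a assume u: "u \<in> Basis"
    have "((\<lambda>y. a * (g y \<bullet> u) + b * (g' y \<bullet> u)) has_derivative
        (\<lambda>w. (a *\<^sub>R H u x + b *\<^sub>R H' u x) \<bullet> w)) (at x)"
      using has_derivative_add[OF has_derivative_mult_right[OF H(2)[OF x u]]
          has_derivative_mult_right[OF H'(2)[OF x u]]] by (simp add: inner_add_left)
    then show "((\<lambda>y. (a *\<^sub>R g y + b *\<^sub>R g' y) \<bullet> u) has_derivative
        (\<lambda>w. (a *\<^sub>R H u x + b *\<^sub>R H' u x) \<bullet> w)) (at x)"
      by (simp add: inner_add_left)
  next
    fix u :: 'a assume u: "u \<in> Basis"
    show "continuous_on S (\<lambda>x. a *\<^sub>R H u x + b *\<^sub>R H' u x)"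
      by (intro continuous_intros H(3)[OF u] H'(3)[OF u])
  qed
qed

lemma harmonic_with_gradient_translate:
  assumes "harmonic_with_gradient f g S"
  shows "harmonic_with_gradient (\<lambda>x. f (x - z)) (\<lambda>x. g (x - z)) ((\<lambda>x. x + z) ` S)"
proof -
  obtain H where H: "\<And>x. x \<in> S \<Longrightarrow> (f has_derivative (\<lambda>u. g x \<bullet> u)) (at x)"
    "\<And>x u. x \<in> S \<Longrightarrow> u \<in> Basis \<Longrightarrow> ((\<lambda>y. g y \<bullet> u) has_derivative (\<lambda>w. H u x \<bullet> w)) (at x)"
    "\<And>u. u \<in> Basis \<Longrightarrow> continuous_on S (H u)"
    "\<And>x. x \<in> S \<Longrightarrow> (\<Sum>u\<in>Basis. H u x \<bullet> u) = 0"
    by (rule harmonic_with_gradientE[OF assms(1)]) blast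
  have d: "((\<lambda>x. x - z) has_derivative (\<lambda>u. u)) (at x)" for x
    by (auto intro!: derivative_eq_intros)
  show ?thesis
  proof (rule harmonic_with_gradientI[where H = "\<lambda>u x. H u (x - z)"])
    fix x assume "x \<in> (\<lambda>x. x + z) ` S"
    then have x: "x - z \<in> S" by auto
    show "((\<lambda>x. f (x - z)) has_derivative (\<lambda>u. g (x - z) \<bullet> u)) (at x)"
      using has_derivative_compose[OF d H(1)[OF x]] by simp
    show "(\<Sum>u\<in>Basis. H u (x - z) \<bullet> u) = 0" using H(4)[OF x] .
    fix u :: 'a assume u: "u \<in> Basis"
    show "((\<lambda>y. g (y - z) \<bullet> u) has_derivative (\<lambda>w. H u (x - z) \<bullet> w)) (at x)"
      using has_derivative_compose[OF d H(2)[OF x u]] by simp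
  next
    fix u :: 'a assume u: "u \<in> Basis"
    show "continuous_on ((\<lambda>x. x + z) ` S) (\<lambda>x. H u (x - z))"
      by (rule continuous_on_compose2[OF H(3)[OF u]]) (auto intro!: continuous_intros)
  qed
qed

lemma dir_deriv_eq:
  assumes "(f has_derivative f') (at x)"
  shows "dir_deriv u f x = f' u"
  using frechet_derivative_at[OF assms] by (simp add: dir_deriv_def)

lemma harmonic_with_gradient_imp:
  assumes "harmonic_with_gradient f g S" and S: "open S"
  shows "C2_on f S" and "\<And>x. x \<in> S \<Longrightarrow> laplacian f x = 0"
    and "\<And>x u. x \<in> S \<Longrightarrow> dir_deriv u f x = g x \<bullet> u"
proof -
  obtain H where H: "\<And>x. x \<in> S \<Longrightarrow> (f has_derivative (\<lambda>u. g x \<bullet> u)) (at x)"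
    "\<And>x u. x \<in> S \<Longrightarrow> u \<in> Basis \<Longrightarrow> ((\<lambda>y. g y \<bullet> u) has_derivative (\<lambda>w. H u x \<bullet> w)) (at x)"
    "\<And>u. u \<in> Basis \<Longrightarrow> continuous_on S (H u)"
    "\<And>x. x \<in> S \<Longrightarrow> (\<Sum>u\<in>Basis. H u x \<bullet> u) = 0"
    by (rule harmonic_with_gradientE[OF assms(1)]) blast
  show d1: "dir_deriv u f x = g x \<bullet> u" if "x \<in> S" for x u
    by (rule dir_deriv_eq[OF H(1)[OF that]])
  have d2: "(dir_deriv u f has_derivative (\<lambda>w. H u x \<bullet> w)) (at x)" if "x \<in> S" "u \<in> Basis" for x u
    by (rule has_derivative_transform_within_open[OF H(2)[OF that] S that(1)]) (simp add: d1)
  have d3: "dir_deriv w (dir_deriv u f) x = H u x \<bullet> w" if "x \<in> S" "u \<in> Basis" for x u w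
    by (rule dir_deriv_eq[OF d2[OF that]])
  show "laplacian f x = 0" if "x \<in> S" for x
    unfolding laplacian_def using H(4)[OF that] d3[OF that] by simp
  show "C2_on f S"
    unfolding C2_on_def
  proof (intro conjI ballI)
    fix u w :: 'a assume u: "u \<in> Basis"
    show "continuous_on S (dir_deriv w (dir_deriv u f))"
      by (subst continuous_on_cong[OF refl d3]) (auto intro!: continuous_intros H(3) u)
  qed (use H(1) d2 in \<open>auto simp: differentiable_def\<close>)
qed

text \<open>
  At a minimum of \<open>f - e |x|\<^sup>2\<close> every second derivative along a coordinate axis is nonnegative, so
  every diagonal entry of the Hessian of \<open>f\<close> is at least \<open>2 e > 0\<close>; but their sum is zero.
\<close>
lemma harmonic_with_gradient_no_local_min:
  fixes f :: "'a::euclidean_space \<Rightarrow> real"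
  assumes h: "harmonic_with_gradient f g S" and S: "open S" "z \<in> S" and e: "e > 0"
    and min: "\<And>x. x \<in> S \<Longrightarrow> f z - e * (z \<bullet> z) \<le> f x - e * (x \<bullet> x)"
  shows False
proof -
  obtain H where H: "\<And>x. x \<in> S \<Longrightarrow> (f has_derivative (\<lambda>u. g x \<bullet> u)) (at x)"
    "\<And>x u. x \<in> S \<Longrightarrow> u \<in> Basis \<Longrightarrow> ((\<lambda>y. g y \<bullet> u) has_derivative (\<lambda>w. H u x \<bullet> w)) (at x)"
    "\<And>u. u \<in> Basis \<Longrightarrow> continuous_on S (H u)"
    "\<And>x. x \<in> S \<Longrightarrow> (\<Sum>u\<in>Basis. H u x \<bullet> u) = 0"
    by (rule harmonic_with_gradientE[OF h]) blast
  obtain d where d: "d > 0" "ball z d \<subseteq> S" using S open_contains_ball by blast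
  have "2 * e \<le> H u z \<bullet> u" if u: "u \<in> Basis" for u
  proof (rule ccontr)
    assume neg: "\<not> 2 * e \<le> H u z \<bullet> u"
    define \<psi> where "\<psi> t = f (z + t *\<^sub>R u) - e * ((z + t *\<^sub>R u) \<bullet> (z + t *\<^sub>R u))" for t
    define \<psi>' where "\<psi>' t = g (z + t *\<^sub>R u) \<bullet> u - 2 * e * ((z + t *\<^sub>R u) \<bullet> u)" for t
    have inS: "z + t *\<^sub>R u \<in> S" if "\<bar>t\<bar> < d" for t
      using that d u by (auto simp: dist_norm intro!: subsetD[OF d(2)])
    have l: "((\<lambda>t. z + t *\<^sub>R u) has_derivative (\<lambda>h. h *\<^sub>R u)) (at t)" for t
      by (auto intro!: derivative_eq_intros)
    have D1: "DERIV \<psi> t :> \<psi>' t" if t: "\<bar>t\<bar> < d" for t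
      unfolding \<psi>_def has_field_derivative_def
      by (rule has_derivative_eq_rhs[OF has_derivative_diff[OF
              has_derivative_compose[OF l H(1)[OF inS[OF t]]]
              has_derivative_mult_right[OF has_derivative_inner[OF l l]]]])
        (auto simp: \<psi>'_def fun_eq_iff inner_commute algebra_simps)
    have D2: "DERIV \<psi>' 0 :> H u z \<bullet> u - 2 * e"
      unfolding \<psi>'_def has_field_derivative_def
      by (rule has_derivative_eq_rhs[OF has_derivative_diff[OF
              has_derivative_compose[OF l H(2)[OF inS u]]
              has_derivative_mult_right[OF has_derivative_inner_left[OF l]]]])
        (use d u in \<open>auto simp: fun_eq_iff inner_commute algebra_simps\<close>)
    have p0: "\<psi>' 0 = 0"
    proof (rule DERIV_local_min[OF D1 d(1)])
      show "\<forall>y. \<bar>0 - y\<bar> < d \<longrightarrow> \<psi> 0 \<le> \<psi> y" using min inS by (auto simp: \<psi>_def)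
    qed (use d in auto)
    obtain d' where d': "d' > 0" "\<And>h. 0 < h \<Longrightarrow> h < d' \<Longrightarrow> \<psi>' h < \<psi>' 0"
      using DERIV_neg_dec_right[OF D2] neg by auto
    define h where "h = min d d' / 2"
    have h: "0 < h" "h < d" "h < d'" using d d' by (auto simp: h_def)
    have "\<psi> h < \<psi> 0"
    proof (rule DERIV_neg_imp_decreasing_open[OF h(1)])
      fix x assume x: "0 < x" "x < h"
      then show "\<exists>y. DERIV \<psi> x :> y \<and> y < 0" using D1[of x] d'(2)[of x] h p0 by auto
    next
      show "continuous_on {0..h} \<psi>"
        using h by (intro continuous_at_imp_continuous_on ballI DERIV_isCont[OF D1]) auto
    qed
    then show False using min[OF inS[of h]] h by (simp add: \<psi>_def)
  qed
  then have "(\<Sum>u\<in>(Basis::'a set). 2 * e) \<le> (\<Sum>u\<in>Basis. H u z \<bullet> u)" by (intro sum_mono)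
  then have "real DIM('a) * (2 * e) \<le> 0" using H(4)[OF S(2)] by simp
  then show False using e DIM_positive[where 'a='a] by (simp add: mult_le_0_iff)
qed

text \<open>
  The boundary hypothesis is a lower limit instead of a boundary value, because the functions to
  which this is applied need not extend to the whole boundary. If \<open>f\<close> were negative
  somewhere, the lower limits would confine a sublevel set of a slight perturbation \<open>f - e |x|\<^sup>2\<close> to
  a compact part of \<open>W\<close>, and the perturbation would attain an interior minimum.
\<close>
lemma harmonic_minimum_principle:
  fixes f :: "'a::euclidean_space \<Rightarrow> real"
  assumes h: "harmonic_with_gradient f g W" and W: "open W" "bounded W"
    and bd: "\<And>z e. z \<in> frontier W \<Longrightarrow> e > 0 \<Longrightarrow> \<exists>d>0. \<forall>x\<in>W \<inter> ball z d. f x > - e"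
    and x: "x \<in> W"
  shows "f x \<ge> 0"
proof (rule ccontr)
  assume "\<not> f x \<ge> 0"
  then have neg: "f x < 0" by simp
  obtain R where R: "R > 0" "\<And>y. y \<in> W \<Longrightarrow> norm y \<le> R" using W(2) bounded_pos by blast
  \<comment> \<open>The perturbation \<open>e |y|\<^sup>2\<close> stays below half of the supposed negative value on all of \<open>W\<close>.\<close>
  define e where "e = - f x / (2 * R\<^sup>2)"
  have e: "e > 0" using neg R unfolding e_def by (intro divide_pos_pos) auto
  define q where "q y = f y - e * (y \<bullet> y)" for y
  have cq: "continuous_on W q"
    unfolding q_def by (intro continuous_intros harmonic_with_gradient_continuous_on[OF h])
  have ey: "e * (y \<bullet> y) \<le> - f x / 2" if "y \<in> W" for y
  proof -
    have "y \<bullet> y \<le> R\<^sup>2" using R(2)[OF that] by (simp add: dot_square_norm power_mono)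
    then have "e * (y \<bullet> y) \<le> e * R\<^sup>2" using e by (intro mult_left_mono) auto
    also have "\<dots> = - f x / 2" using R(1) by (simp add: e_def)
    finally show ?thesis .
  qed
  define L where "L = {y \<in> W. q y \<le> q x}"
  have Lf: "f y \<le> f x / 2" if "y \<in> L" for y
  proof -
    have "f y \<le> f x - e * (x \<bullet> x) + e * (y \<bullet> y)" using that by (simp add: L_def q_def)
    also have "\<dots> \<le> f x / 2" 
      using ey[of y] that mult_nonneg_nonneg[OF less_imp_le[OF e] inner_ge_zero[of x]]
      unfolding L_def by simp
    finally show ?thesis .
  qed
  have "closed L"
    unfolding closed_limpt
  proof (intro allI impI)
    fix z assume z: "z islimpt L"
    then have "z islimpt W" using islimpt_subset[of z L W] by (auto simp: L_def)
    then have zc: "z \<in> closure W" by (simp add: closure_def)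
    have zW: "z \<in> W"
    proof (rule ccontr)
      assume "z \<notin> W"
      then have "z \<in> frontier W" using zc W(1) by (simp add: frontier_def interior_open)
      from bd[OF this, of "- f x / 2"] neg obtain d where d: "d > 0"
        "\<forall>x'\<in>W \<inter> ball z d. f x' > f x / 2" by auto
      obtain y where "y \<in> L" "dist y z < d" using z d(1) unfolding islimpt_approachable by blast
      then have "y \<in> W \<inter> ball z d" by (simp add: L_def dist_commute)
      then have "f x / 2 < f y" using d(2) by blast
      then show False using Lf[OF \<open>y \<in> L\<close>] by simp
    qed
    have "L = W \<inter> q -` {..q x}" by (auto simp: L_def)
    then have "closedin (top_of_set W) L"
      using continuous_closedin_preimage[OF cq, of "{..q x}"] by simp
    then obtain T where T: "closed T" "L = W \<inter> T" unfolding closedin_closed by metis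
    then have "z islimpt T" by (intro islimpt_subset[OF z]) simp
    then have "z \<in> T" using T(1) unfolding closed_limpt by blast
    then show "z \<in> L" using T zW by simp
  qed
  moreover have "bounded L" using W(2) by (rule bounded_subset) (auto simp: L_def)
  ultimately have "compact L" by (simp add: compact_eq_bounded_closed)
  moreover have "L \<noteq> {}" using x by (auto simp: L_def)
  moreover have "continuous_on L q" by (rule continuous_on_subset[OF cq]) (auto simp: L_def)
  ultimately obtain z where z: "z \<in> L" "\<forall>y\<in>L. q z \<le> q y"
    using continuous_attains_inf[of L q] by metis
  have "q z \<le> q y" if "y \<in> W" for y
    using that z by (cases "y \<in> L") (auto simp: L_def)
  then show False
    using harmonic_with_gradient_no_local_min[OF h W(1) _ e, of z] z(1) by (auto simp: L_def q_def)
qed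

section \<open>The Neumann Green's function of the ball\<close>

text \<open>
  Gradient and Hessian rows of the two harmonic building blocks of the Green's function,
  \<open>1 / |y|\<close> and \<open>ln (|y| - y \<bullet> e)\<close>. The second is regular off the ray from the origin through the
  unit vector \<open>e\<close>.
\<close>
definition newton_grad :: "real^3 \<Rightarrow> real^3" where
  "newton_grad y = - (1 / norm y ^ 3) *\<^sub>R y"

definition newton_hess :: "real^3 \<Rightarrow> real^3 \<Rightarrow> real^3" where
  "newton_hess u y = (3 * (y \<bullet> u) / norm y ^ 5) *\<^sub>R y - (1 / norm y ^ 3) *\<^sub>R u"

definition log_grad :: "real^3 \<Rightarrow> real^3 \<Rightarrow> real^3" where
  "log_grad e y = (1 / (norm y - y \<bullet> e)) *\<^sub>R ((1 / norm y) *\<^sub>R y - e)"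

definition log_hess :: "real^3 \<Rightarrow> real^3 \<Rightarrow> real^3 \<Rightarrow> real^3" where
  "log_hess e u y = (1 / (norm y - y \<bullet> e)) *\<^sub>R ((1 / norm y) *\<^sub>R u - ((y \<bullet> u) / norm y ^ 3) *\<^sub>R y)
     - (((y \<bullet> u) / norm y - e \<bullet> u) / (norm y - y \<bullet> e)\<^sup>2) *\<^sub>R ((1 / norm y) *\<^sub>R y - e)"

lemma norm_has_derivative:
  fixes y :: "'a::real_inner"
  assumes "y \<noteq> 0" shows "(norm has_derivative (\<lambda>w. (y \<bullet> w) / norm y)) (at y)"
  using has_derivative_norm[OF assms]
  by (rule has_derivative_eq_rhs) (auto simp: sgn_div_norm fun_eq_iff inner_commute divide_inverse mult.commute)

lemma newton_has_derivative:
  assumes y: "y \<noteq> 0"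
  shows "((\<lambda>y. 1 / norm y) has_derivative (\<lambda>w. newton_grad y \<bullet> w)) (at y)"
  by (rule has_derivative_eq_rhs,
      rule has_derivative_divide[OF has_derivative_const norm_has_derivative[OF y]])
    (use y in \<open>auto simp: newton_grad_def fun_eq_iff divide_simps power3_eq_cube\<close>)

lemma newton_grad_has_derivative:
  assumes y: "y \<noteq> 0"
  shows "((\<lambda>y. newton_grad y \<bullet> u) has_derivative (\<lambda>w. newton_hess u y \<bullet> w)) (at y)"
proof -
  have "((\<lambda>y. - ((y \<bullet> u) / norm y ^ 3)) has_derivative
      (\<lambda>w. - (((w \<bullet> u) * norm y ^ 3 - (y \<bullet> u) * (3 * norm y ^ 2 * ((y \<bullet> w) / norm y)))
        / (norm y ^ 3 * norm y ^ 3)))) (at y)"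
    by (rule has_derivative_eq_rhs, rule has_derivative_minus,
        rule has_derivative_divide'[OF has_derivative_inner_left[OF has_derivative_ident]
          has_derivative_power[OF norm_has_derivative[OF y]]])
      (use y in \<open>auto simp: fun_eq_iff\<close>)
  moreover have "- (((w \<bullet> u) * norm y ^ 3 - (y \<bullet> u) * (3 * norm y ^ 2 * ((y \<bullet> w) / norm y)))
        / (norm y ^ 3 * norm y ^ 3)) = newton_hess u y \<bullet> w" for w
    using y by (simp add: newton_hess_def inner_diff_left inner_commute[of w u] field_simps
        power2_eq_square power3_eq_cube eval_nat_numeral)
  ultimately show ?thesis by (simp add: newton_grad_def)
qed

lemma sum_Basis_square: "(\<Sum>u\<in>Basis. (y \<bullet> u) * (y \<bullet> u)) = (norm y)\<^sup>2"
  by (simp add: euclidean_inner[of y y, symmetric] power2_norm_eq_inner)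

lemma newton_hess_trace:
  assumes y: "y \<noteq> 0"
  shows "(\<Sum>u\<in>Basis. newton_hess u y \<bullet> u) = 0"
proof -
  have "(\<Sum>u\<in>Basis. newton_hess u y \<bullet> u)
      = (\<Sum>u\<in>Basis. (3 / norm y ^ 5) * ((y \<bullet> u) * (y \<bullet> u)) - 1 / norm y ^ 3)"
    by (intro sum.cong) (auto simp: newton_hess_def inner_diff_left)
  also have "\<dots> = (3 / norm y ^ 5) * (norm y)\<^sup>2 - 3 / norm y ^ 3"
    by (simp only: sum_subtractf sum_distrib_left[symmetric] sum_Basis_square) simp
  also have "\<dots> = 0" using y by (simp add: field_simps eval_nat_numeral)
  finally show ?thesis .
qed

lemma harmonic_newton:
  "harmonic_with_gradient (\<lambda>y::real^3. 1 / norm y) newton_grad (- {0})"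
proof (rule harmonic_with_gradientI[where H = newton_hess])
  fix u :: "real^3"
  show "continuous_on (- {0}) (newton_hess u)"
    unfolding newton_hess_def by (intro continuous_intros) auto
qed (auto intro: newton_has_derivative newton_grad_has_derivative newton_hess_trace)

lemma pole_denominator_has_derivative:
  fixes y e :: "real^3"
  assumes "norm y - y \<bullet> e > 0" "norm e = 1"
  shows "((\<lambda>y. norm y - y \<bullet> e) has_derivative (\<lambda>w. (y \<bullet> w) / norm y - w \<bullet> e)) (at y)"
  using assms by (intro has_derivative_diff norm_has_derivative has_derivative_inner_left
      has_derivative_ident) auto

lemma log_has_derivative:
  assumes s: "norm y - y \<bullet> e > 0" and e: "norm e = 1"
  shows "((\<lambda>y. ln (norm y - y \<bullet> e)) has_derivative (\<lambda>w. log_grad e y \<bullet> w)) (at y)"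
  by (rule has_derivative_eq_rhs,
      rule has_derivative_ln[OF s pole_denominator_has_derivative[OF s e]])
    (auto simp: log_grad_def fun_eq_iff inner_diff_left inner_diff_right inner_commute
      divide_inverse mult.commute)

lemma log_grad_has_derivative:
  assumes s: "norm y - y \<bullet> e > 0" and e: "norm e = 1"
  shows "((\<lambda>y. log_grad e y \<bullet> u) has_derivative (\<lambda>w. log_hess e u y \<bullet> w)) (at y)"
proof -
  have y: "y \<noteq> 0" using s by auto
  let ?s = "norm y - y \<bullet> e"
  have 1: "((\<lambda>y. (y \<bullet> u) / norm y - e \<bullet> u) has_derivative
      (\<lambda>w. ((w \<bullet> u) * norm y - (y \<bullet> u) * ((y \<bullet> w) / norm y)) / (norm y * norm y))) (at y)"
    by (rule has_derivative_eq_rhs, rule has_derivative_diff[OF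
        has_derivative_divide'[OF has_derivative_inner_left[OF has_derivative_ident]
          norm_has_derivative[OF y]] has_derivative_const])
      (use y in auto)
  have "((\<lambda>y. ((y \<bullet> u) / norm y - e \<bullet> u) / (norm y - y \<bullet> e)) has_derivative
      (\<lambda>w. (((w \<bullet> u) * norm y - (y \<bullet> u) * ((y \<bullet> w) / norm y)) / (norm y * norm y) * ?s
         - ((y \<bullet> u) / norm y - e \<bullet> u) * ((y \<bullet> w) / norm y - w \<bullet> e)) / (?s * ?s))) (at y)"
    by (rule has_derivative_divide'[OF 1 pole_denominator_has_derivative[OF s e]]) (use s in auto)
  moreover have "(((w \<bullet> u) * norm y - (y \<bullet> u) * ((y \<bullet> w) / norm y)) / (norm y * norm y) * ?s
         - ((y \<bullet> u) / norm y - e \<bullet> u) * ((y \<bullet> w) / norm y - w \<bullet> e)) / (?s * ?s)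
      = log_hess e u y \<bullet> w" for w
  proof -
    have "((w \<bullet> u) * norm y - (y \<bullet> u) * ((y \<bullet> w) / norm y)) / (norm y * norm y)
        = (u \<bullet> w) / norm y - (y \<bullet> u) / norm y ^ 3 * (y \<bullet> w)"
      using y by (simp add: inner_commute[of w u] field_simps power3_eq_cube)
    then have "(((w \<bullet> u) * norm y - (y \<bullet> u) * ((y \<bullet> w) / norm y)) / (norm y * norm y) * ?s
         - ((y \<bullet> u) / norm y - e \<bullet> u) * ((y \<bullet> w) / norm y - w \<bullet> e)) / (?s * ?s)
        = ((u \<bullet> w) / norm y - (y \<bullet> u) / norm y ^ 3 * (y \<bullet> w)) / ?s
         - ((y \<bullet> u) / norm y - e \<bullet> u) * ((y \<bullet> w) / norm y - w \<bullet> e) / (?s * ?s)"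
      using s by (simp add: diff_divide_distrib)
    also have "\<dots> = log_hess e u y \<bullet> w"
      by (simp add: log_hess_def inner_diff_left inner_commute[of w e] power2_eq_square)
    finally show ?thesis .
  qed
  ultimately show ?thesis
    by (simp add: log_grad_def inner_diff_left)
qed

text \<open>
  With \<open>s = |y| - y \<bullet> e\<close> and \<open>n = y/|y| - e\<close> the trace is \<open>2 / (|y| s) - |n|\<^sup>2 / s\<^sup>2\<close>, and
  \<open>|n|\<^sup>2 = 2 s / |y|\<close> because \<open>e\<close> is a unit vector.
\<close>
lemma log_hess_trace:
  assumes s: "norm y - y \<bullet> e > 0" and e: "norm e = 1"
  shows "(\<Sum>u\<in>Basis. log_hess e u y \<bullet> u) = 0"
proof -
  have y: "norm y > 0" using s by auto
  let ?s = "norm y - y \<bullet> e" let ?n = "(1 / norm y) *\<^sub>R y - e"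
  have "(\<Sum>u\<in>Basis. log_hess e u y \<bullet> u)
      = (\<Sum>u\<in>Basis. 1 / (norm y * ?s) - 1 / (norm y ^ 3 * ?s) * ((y \<bullet> u) * (y \<bullet> u))
          - 1 / ?s\<^sup>2 * ((?n \<bullet> u) * (?n \<bullet> u)))"
  proof (intro sum.cong refl)
    fix u :: "real^3" assume u: "u \<in> Basis"
    define a where "a = ?n \<bullet> u"
    have "(y \<bullet> u) / norm y - e \<bullet> u = a" by (simp add: a_def inner_diff_left)
    then have "log_hess e u y \<bullet> u
        = 1 / ?s * (1 / norm y * (u \<bullet> u) - (y \<bullet> u) / norm y ^ 3 * (y \<bullet> u)) - a / ?s\<^sup>2 * a"
      by (simp only: log_hess_def inner_diff_left[of _ _ u] inner_scaleR_left) (simp add: a_def inner_diff_left)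
    then show "log_hess e u y \<bullet> u = 1 / (norm y * ?s)
        - 1 / (norm y ^ 3 * ?s) * ((y \<bullet> u) * (y \<bullet> u)) - 1 / ?s\<^sup>2 * ((?n \<bullet> u) * (?n \<bullet> u))"
      unfolding a_def[symmetric] using u by (simp add: right_diff_distrib mult.commute)
  qed
  also have "\<dots> = 3 / (norm y * ?s) - 1 / (norm y ^ 3 * ?s) * (norm y)\<^sup>2 - 1 / ?s\<^sup>2 * (norm ?n)\<^sup>2"
    by (simp only: sum_subtractf sum_distrib_left[symmetric] sum_Basis_square) simp
  also have "(norm ?n)\<^sup>2 = 2 * ?s / norm y"
  proof -
    have "(norm ?n)\<^sup>2 = ?n \<bullet> ?n" by (rule power2_norm_eq_inner)
    also have "\<dots> = (y \<bullet> y) / (norm y)\<^sup>2 - 2 * (y \<bullet> e) / norm y + (e \<bullet> e)"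
      by (simp add: inner_diff_left inner_diff_right inner_commute[of e y]
          power2_eq_square algebra_simps diff_divide_distrib add_divide_distrib)
    also have "\<dots> = 2 * ?s / norm y"
      using e y by (simp add: dot_square_norm field_simps power2_eq_square)
    finally show ?thesis .
  qed
  also have "3 / (norm y * ?s) - 1 / (norm y ^ 3 * ?s) * (norm y)\<^sup>2 - 1 / ?s\<^sup>2 * (2 * ?s / norm y) = 0"
    using y s by (simp add: divide_simps power2_eq_square power3_eq_cube)
  finally show ?thesis .
qed

text \<open>
  Seen from \<open>e\<close>, the closed ball lies in the half space opposite to \<open>e\<close>, and so it avoids the ray on
  which the logarithm is singular.
\<close>
lemma pole_denominator_pos:
  fixes x e :: "real^3"
  assumes "norm x \<le> 1" "norm e = 1" "x \<noteq> e"
  shows "norm (x - e) - (x - e) \<bullet> e > 0"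
proof -
  have "x \<bullet> e \<le> norm x * norm e" by (rule norm_cauchy_schwarz)
  then have "(x - e) \<bullet> e \<le> 0"
    using assms by (simp add: inner_diff_left dot_square_norm)
  moreover have "norm (x - e) > 0" using assms by simp
  ultimately show ?thesis by linarith
qed

lemma neumann_green_eq:
  assumes "norm x \<le> 1" "norm e = 1" "x \<noteq> e"
  shows "neumann_green x e = 2 * (1 / norm (x - e)) + ln 2 - ln (norm (x - e) - (x - e) \<bullet> e)"
proof -
  have "1 - x \<bullet> e + norm (x - e) = norm (x - e) - (x - e) \<bullet> e"
    using assms by (simp add: inner_diff_left dot_square_norm)
  then show ?thesis
    unfolding neumann_green_def using pole_denominator_pos[OF assms] by (simp add: ln_div)
qed

definition green_grad :: "real^3 \<Rightarrow> real^3 \<Rightarrow> real^3" where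
  "green_grad x e = 2 *\<^sub>R newton_grad (x - e) - log_grad e (x - e)"

definition green_hess :: "real^3 \<Rightarrow> real^3 \<Rightarrow> real^3 \<Rightarrow> real^3" where
  "green_hess u x e = 2 *\<^sub>R newton_hess u (x - e) - log_hess e u (x - e)"

lemma neumann_green_has_derivative:
  assumes x: "x \<in> ball 0 1" and e: "e \<in> sphere 0 1"
  shows "((\<lambda>x. neumann_green x e) has_derivative (\<lambda>w. green_grad x e \<bullet> w)) (at x)"
proof -
  have xe: "norm x \<le> 1" "norm e = 1" "x \<noteq> e" using x e by auto
  have d: "((\<lambda>x. x - e) has_derivative (\<lambda>u. u)) (at x)"
    by (auto intro!: derivative_eq_intros)
  have 1: "((\<lambda>x. 1 / norm (x - e)) has_derivative (\<lambda>w. newton_grad (x - e) \<bullet> w)) (at x)"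
    using has_derivative_compose[OF d newton_has_derivative] xe by simp
  have 2: "((\<lambda>x. ln (norm (x - e) - (x - e) \<bullet> e)) has_derivative (\<lambda>w. log_grad e (x - e) \<bullet> w)) (at x)"
    using has_derivative_compose[OF d log_has_derivative[OF pole_denominator_pos[OF xe] xe(2)]] by simp
  have 3: "((\<lambda>x. 2 * (1 / norm (x - e)) + ln 2 - ln (norm (x - e) - (x - e) \<bullet> e))
      has_derivative (\<lambda>w. green_grad x e \<bullet> w)) (at x)"
    by (rule has_derivative_eq_rhs, rule has_derivative_diff[OF has_derivative_add[OF
          has_derivative_mult_right[OF 1] has_derivative_const] 2])
      (simp add: green_grad_def inner_diff_left)
  show ?thesis
  proof (rule has_derivative_transform_within_open[OF 3 open_ball x])
    fix z :: "real^3" assume "z \<in> ball 0 1"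
    then have "norm z \<le> 1" "z \<noteq> e" using e by auto
    then show "2 * (1 / norm (z - e)) + ln 2 - ln (norm (z - e) - (z - e) \<bullet> e) = neumann_green z e"
      using neumann_green_eq xe(2) by simp
  qed
qed

lemma green_grad_has_derivative:
  assumes x: "x \<in> ball 0 1" and e: "e \<in> sphere 0 1"
  shows "((\<lambda>x. green_grad x e \<bullet> u) has_derivative (\<lambda>w. green_hess u x e \<bullet> w)) (at x)"
proof -
  have xe: "norm x \<le> 1" "norm e = 1" "x \<noteq> e" using x e by auto
  have d: "((\<lambda>x. x - e) has_derivative (\<lambda>u. u)) (at x)"
    by (auto intro!: derivative_eq_intros)
  have 1: "((\<lambda>x. newton_grad (x - e) \<bullet> u) has_derivative (\<lambda>w. newton_hess u (x - e) \<bullet> w)) (at x)"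
    using has_derivative_compose[OF d newton_grad_has_derivative] xe by simp
  have 2: "((\<lambda>x. log_grad e (x - e) \<bullet> u) has_derivative (\<lambda>w. log_hess e u (x - e) \<bullet> w)) (at x)"
    using has_derivative_compose[OF d log_grad_has_derivative[OF pole_denominator_pos[OF xe] xe(2)]]
    by simp
  show ?thesis
    using has_derivative_diff[OF has_derivative_mult_right[OF 1, of 2] 2]
    by (simp add: green_grad_def green_hess_def inner_diff_left)
qed

lemma green_hess_trace:
  assumes "x \<in> ball 0 1" "e \<in> sphere 0 1"
  shows "(\<Sum>u\<in>Basis. green_hess u x e \<bullet> u) = 0"
proof -
  have xe: "norm x \<le> 1" "norm e = 1" "x \<noteq> e" using assms by auto
  have "(\<Sum>u\<in>Basis. green_hess u x e \<bullet> u)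
      = 2 * (\<Sum>u\<in>Basis. newton_hess u (x - e) \<bullet> u) - (\<Sum>u\<in>Basis. log_hess e u (x - e) \<bullet> u)"
    by (simp add: green_hess_def inner_diff_left sum_subtractf sum_distrib_left)
  then show ?thesis
    using newton_hess_trace[of "x - e"] log_hess_trace[OF pole_denominator_pos[OF xe] xe(2)] xe by simp
qed

lemma continuous_on_green:
  assumes A: "A \<subseteq> cball 0 1" and K: "K \<subseteq> sphere 0 1" and disj: "A \<inter> K = {}"
  shows "continuous_on (A \<times> K) (\<lambda>(x, e). neumann_green x e)"
    and "continuous_on (A \<times> K) (\<lambda>(x, e). green_grad x e)"
    and "continuous_on (A \<times> K) (\<lambda>(x, e). green_hess u x e)"
proof -
  have ne: "fst p \<noteq> snd p" if "p \<in> A \<times> K" for p using that disj by auto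
  have pos: "norm (fst p - snd p) - (fst p - snd p) \<bullet> snd p > 0" if "p \<in> A \<times> K" for p
    using that A K ne[OF that] by (intro pole_denominator_pos) auto
  have nz: "norm (fst p - snd p) - (fst p - snd p) \<bullet> snd p \<noteq> 0" if "p \<in> A \<times> K" for p
    using pos[OF that] by simp
  have "continuous_on (A \<times> K)
      (\<lambda>p. 2 * (1 / norm (fst p - snd p)) + ln 2 - ln (norm (fst p - snd p) - (fst p - snd p) \<bullet> snd p))"
    using nz ne by (intro continuous_intros) auto
  then show "continuous_on (A \<times> K) (\<lambda>(x, e). neumann_green x e)"
  proof (rule continuous_on_eq)
    fix p assume p: "p \<in> A \<times> K"
    then have "norm (fst p) \<le> 1" "norm (snd p) = 1" using A K by auto
    then show "2 * (1 / norm (fst p - snd p)) + ln 2 - ln (norm (fst p - snd p) - (fst p - snd p) \<bullet> snd p)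
        = (case p of (x, e) \<Rightarrow> neumann_green x e)"
      using neumann_green_eq[of "fst p" "snd p"] ne[OF p] by (simp add: split_beta)
  qed
  show "continuous_on (A \<times> K) (\<lambda>(x, e). green_grad x e)"
    unfolding split_beta green_grad_def newton_grad_def log_grad_def
    using nz ne by (intro continuous_intros) auto
  show "continuous_on (A \<times> K) (\<lambda>(x, e). green_hess u x e)"
    unfolding split_beta green_hess_def newton_hess_def log_hess_def
    using nz ne by (intro continuous_intros) auto
qed

text \<open>
  The identity behind both the normal derivative and the domination principle: the right-hand
  side is \<open>4 \<pi>\<close> times the Poisson kernel, minus one. The Newtonian part contributes
  \<open>q / r\<^sup>3 - 1 / r\<close> with \<open>q = 1 - |x|\<^sup>2\<close> and \<open>r = |x - e|\<close>; in the logarithmic part the numerator of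
  the radial derivative is divisible by the denominator \<open>s\<close>, leaving exactly \<open>1 / r - 1\<close>.
\<close>
lemma green_grad_radial:
  assumes x: "norm x \<le> 1" and e: "norm e = 1" and ne: "x \<noteq> e"
  shows "x \<bullet> green_grad x e = (1 - (norm x)\<^sup>2) / norm (x - e) ^ 3 - 1"
proof -
  define r where "r = norm (x - e)"
  define q where "q = 1 - (norm x)\<^sup>2"
  define s where "s = r - (x - e) \<bullet> e"
  have r: "r > 0" using ne by (simp add: r_def)
  have s0: "s > 0" using pole_denominator_pos[OF assms] by (simp add: s_def r_def)
  have "r\<^sup>2 = (x - e) \<bullet> (x - e)" unfolding r_def by (rule power2_norm_eq_inner)
  also have "\<dots> = (norm x)\<^sup>2 - 2 * (x \<bullet> e) + 1"
    using e by (simp add: inner_diff_left inner_diff_right inner_commute[of e x]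
        dot_square_norm[of x] dot_square_norm[of e])
  finally have xe: "x \<bullet> e = (2 - q - r\<^sup>2) / 2" by (simp add: q_def)
  have s: "s = (q + r\<^sup>2 + 2 * r) / 2"
    using e xe by (simp add: s_def inner_diff_left dot_square_norm field_simps)
  have xy: "x \<bullet> (x - e) = (r\<^sup>2 - q) / 2"
    using xe by (simp add: inner_diff_right dot_square_norm q_def field_simps)
  have 1: "x \<bullet> newton_grad (x - e) = - ((r\<^sup>2 - q) / 2) / r ^ 3"
    unfolding newton_grad_def r_def[symmetric] inner_scaleR_right xy by simp
  have "x \<bullet> log_grad e (x - e) = 1 / s * (1 / r * (x \<bullet> (x - e)) - x \<bullet> e)"
    by (simp only: log_grad_def r_def[symmetric] s_def[symmetric] inner_scaleR_right
        inner_diff_right[of x "(1 / r) *\<^sub>R (x - e)" e])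
  also have "\<dots> = ((r\<^sup>2 - q) / 2 / r - (2 - q - r\<^sup>2) / 2) / s"
    unfolding xy xe by simp
  also have "(r\<^sup>2 - q) / 2 / r - (2 - q - r\<^sup>2) / 2 = s * (1 - 1 / r)"
    unfolding s using r by (simp add: field_simps power2_eq_square)
  finally have 2: "x \<bullet> log_grad e (x - e) = 1 - 1 / r" using s0 by simp
  have "x \<bullet> green_grad x e = 2 * (- ((r\<^sup>2 - q) / 2) / r ^ 3) - (1 - 1 / r)"
    using 1 2 by (simp add: green_grad_def inner_diff_right)
  also have "\<dots> = q / r ^ 3 - 1" using r by (simp add: field_simps power2_eq_square power3_eq_cube)
  finally show ?thesis by (simp add: q_def r_def)
qed

lemma neumann_green_0: "norm e = 1 \<Longrightarrow> neumann_green 0 e = 2"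
  by (simp add: neumann_green_def)

text \<open>
  Both bounds also hold on the diagonal, where the conventions \<open>2 / 0 = 0\<close> and \<open>ln 0 = 0\<close> make all
  terms zero. Below, \<open>2 / r \<ge> 1\<close> as \<open>r \<le> 2\<close>, while the logarithm is at least \<open>-1\<close>.
\<close>
lemma neumann_green_bounds:
  assumes x: "norm x \<le> 1" and e: "norm e = 1"
  shows "0 \<le> neumann_green x e" "neumann_green x e \<le> 4 / norm (x - e)"
proof -
  have "0 \<le> neumann_green x e \<and> neumann_green x e \<le> 4 / norm (x - e)"
  proof (cases "x = e")
    case True
    then show ?thesis using e by (simp add: neumann_green_def dot_square_norm)
  next
    case ne: False
    define r where "r = norm (x - e)"
    have "\<bar>x \<bullet> e\<bar> \<le> norm x * norm e" by (rule Cauchy_Schwarz_ineq2)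
    then have xe: "\<bar>x \<bullet> e\<bar> \<le> 1" using x e by simp
    have r: "0 < r" using ne by (simp add: r_def)
    have r2: "r \<le> 2" using norm_triangle_ineq4[of x e] x e by (simp add: r_def)
    have G: "neumann_green x e = 2 / r + ln (2 / (1 - x \<bullet> e + r))"
      by (simp add: neumann_green_def r_def)
    have "ln (2 / (1 - x \<bullet> e + r)) \<le> 2 / (1 - x \<bullet> e + r)"
      by (rule less_imp_le[OF ln_less_self]) (use xe r in simp)
    also have "\<dots> \<le> 2 / r" using xe r by (intro divide_left_mono) auto
    finally have 1: "neumann_green x e \<le> 4 / r" using G by simp
    have "1 - (1 - x \<bullet> e + r) / 2 \<ge> - 1" using xe r2 by simp
    moreover have "ln ((1 - x \<bullet> e + r) / 2) \<le> (1 - x \<bullet> e + r) / 2 - 1"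
      by (rule ln_le_minus_one) (use xe r in simp)
    moreover have "ln (2 / (1 - x \<bullet> e + r)) = - ln ((1 - x \<bullet> e + r) / 2)"
      using xe r by (simp add: ln_div)
    ultimately have "ln (2 / (1 - x \<bullet> e + r)) \<ge> -1" by linarith
    moreover have "2 / r \<ge> 1" using r r2 by simp
    ultimately have "0 \<le> neumann_green x e" using G by linarith
    then show ?thesis using 1 by (simp add: r_def)
  qed
  then show "0 \<le> neumann_green x e" "neumann_green x e \<le> 4 / norm (x - e)" by auto
qed

section \<open>Potentials of surface charges\<close>

lemma sets_sphere_measure [simp, measurable_cong]: "sets sphere_measure = sets borel"
  by (simp add: sphere_measure_def)

lemma space_sphere_measure [simp]: "space sphere_measure = UNIV"
  by (simp add: sphere_measure_def)

definition green_potential :: "(real^3 \<Rightarrow> real) \<Rightarrow> real^3 \<Rightarrow> real" where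
  "green_potential \<rho> x = (\<integral>y. \<rho> y * neumann_green x y \<partial>sphere_measure)"

definition green_potential_grad :: "(real^3 \<Rightarrow> real) \<Rightarrow> real^3 \<Rightarrow> real^3" where
  "green_potential_grad \<rho> x = (\<integral>y. \<rho> y *\<^sub>R green_grad x y \<partial>sphere_measure)"

lemma continuous_on_green_potential:
  assumes \<rho>: "integrable sphere_measure \<rho>" and K: "compact K" "K \<subseteq> sphere 0 1"
    and supp: "\<And>y. y \<notin> K \<Longrightarrow> \<rho> y = 0"
  shows "continuous_on (cball 0 1 - K) (green_potential \<rho>)"
    and "continuous_on (cball 0 1 - K) (green_potential_grad \<rho>)"
proof -
  have disj: "(cball 0 1 - K) \<inter> K = {}" by auto
  note c = continuous_on_green[OF Diff_subset K(2) disj]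
  show "continuous_on (cball 0 1 - K) (green_potential \<rho>)"
    using continuous_on_kernel_integral[OF sets_sphere_measure K(1) \<rho> supp c(1)]
    by (simp add: green_potential_def[abs_def])
  show "continuous_on (cball 0 1 - K) (green_potential_grad \<rho>)"
    using continuous_on_kernel_integral[OF sets_sphere_measure K(1) \<rho> supp c(2)]
    by (simp add: green_potential_grad_def[abs_def])
qed

lemma integrable_green:
  assumes \<rho>: "integrable sphere_measure \<rho>" and K: "compact K" "K \<subseteq> sphere 0 1"
    and supp: "\<And>y. y \<notin> K \<Longrightarrow> \<rho> y = 0" and x: "x \<in> cball 0 1 - K"
  shows "integrable sphere_measure (\<lambda>y. \<rho> y * neumann_green x y)"
    and "integrable sphere_measure (\<lambda>y. \<rho> y *\<^sub>R green_grad x y)"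
proof -
  have A: "{x} \<subseteq> cball 0 1" "{x} \<inter> K = {}" using x by auto
  note c = continuous_on_green[OF A(1) K(2) A(2)]
  have "continuous_on K (neumann_green x)"
    by (rule continuous_on_section[OF c(1)]) simp
  then show "integrable sphere_measure (\<lambda>y. \<rho> y * neumann_green x y)"
    using integrable_scaleR_continuous_on[OF sets_sphere_measure K(1) \<rho> supp, of "neumann_green x"]
    by simp
  have "continuous_on K (green_grad x)"
    by (rule continuous_on_section[OF c(2)]) simp
  then show "integrable sphere_measure (\<lambda>y. \<rho> y *\<^sub>R green_grad x y)"
    using integrable_scaleR_continuous_on[OF sets_sphere_measure K(1) \<rho> supp, of "green_grad x"]
    by simp
qed

lemma harmonic_green_potential:
  assumes \<rho>: "integrable sphere_measure \<rho>"
    and supp: "\<And>y. y \<notin> sphere 0 1 \<Longrightarrow> \<rho> y = 0"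
  shows "harmonic_with_gradient (green_potential \<rho>) (green_potential_grad \<rho>) (ball 0 1)"
proof (rule harmonic_with_gradientI
    [where H = "\<lambda>u x. \<integral>y. \<rho> y *\<^sub>R green_hess u x y \<partial>sphere_measure"])
  let ?B = "ball (0::real^3) 1" and ?S = "sphere (0::real^3) 1"
  have A: "?B \<subseteq> cball 0 1" "?B \<inter> ?S = {}" by auto
  note c = continuous_on_green[OF A(1) subset_refl A(2)]
  have c0: "continuous_on ?S (neumann_green x)" if "x \<in> ?B" for x
    by (rule continuous_on_section[OF c(1) that])
  have c1: "continuous_on ?S (green_grad x)" if "x \<in> ?B" for x
    by (rule continuous_on_section[OF c(2) that])
  have c2: "continuous_on ?S (green_hess u x)" if "x \<in> ?B" for x u
    by (rule continuous_on_section[OF c(3) that])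
  note kd = has_derivative_kernel_integral[OF sets_sphere_measure compact_sphere \<rho> supp open_ball]
  fix x assume x: "x \<in> ?B"
  show "(green_potential \<rho> has_derivative (\<lambda>u. green_potential_grad \<rho> x \<bullet> u)) (at x)"
    using kd[OF _ x c0 neumann_green_has_derivative c(2)]
    unfolding green_potential_def[abs_def] green_potential_grad_def by simp
  have ih: "integrable sphere_measure (\<lambda>y. \<rho> y *\<^sub>R green_hess u x y)" for u
    using integrable_scaleR_continuous_on[OF sets_sphere_measure compact_sphere \<rho> supp c2[OF x]] by simp
  have "(\<Sum>u\<in>Basis. (\<integral>y. \<rho> y *\<^sub>R green_hess u x y \<partial>sphere_measure) \<bullet> u)
      = (\<integral>y. (\<Sum>u\<in>Basis. (\<rho> y *\<^sub>R green_hess u x y) \<bullet> u) \<partial>sphere_measure)"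
    by (subst Bochner_Integration.integral_sum)
      (simp_all only: integrable_inner_left[OF ih] integral_inner_left[OF ih])
  also have "(\<lambda>y. \<Sum>u\<in>Basis. (\<rho> y *\<^sub>R green_hess u x y) \<bullet> u) = (\<lambda>y. 0)"
  proof
    fix y
    have "(\<Sum>u\<in>Basis. (\<rho> y *\<^sub>R green_hess u x y) \<bullet> u) = \<rho> y * (\<Sum>u\<in>Basis. green_hess u x y \<bullet> u)"
      by (simp add: sum_distrib_left)
    then show "(\<Sum>u\<in>Basis. (\<rho> y *\<^sub>R green_hess u x y) \<bullet> u) = 0"
      using supp[of y] green_hess_trace[OF x, of y] by (cases "y \<in> ?S") auto
  qed
  finally show "(\<Sum>u\<in>Basis. (\<integral>y. \<rho> y *\<^sub>R green_hess u x y \<partial>sphere_measure) \<bullet> u) = 0" by simp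
  fix u :: "real^3"
  have "((\<lambda>x. \<integral>y. \<rho> y * (green_grad x y \<bullet> u) \<partial>sphere_measure) has_derivative
      (\<lambda>w. (\<integral>y. \<rho> y *\<^sub>R green_hess u x y \<partial>sphere_measure) \<bullet> w)) (at x)"
  proof (rule kd[OF _ x])
    show "continuous_on ?S (\<lambda>y. green_grad z y \<bullet> u)" if "z \<in> ?B" for z
      by (intro continuous_intros c1 that)
  qed (use c(3) green_grad_has_derivative in auto)
  then show "((\<lambda>y. green_potential_grad \<rho> y \<bullet> u) has_derivative
      (\<lambda>w. (\<integral>y. \<rho> y *\<^sub>R green_hess u x y \<partial>sphere_measure) \<bullet> w)) (at x)"
  proof (rule has_derivative_transform_within_open[OF _ open_ball x])
    fix z assume z: "z \<in> ?B"
    have "integrable sphere_measure (\<lambda>y. \<rho> y *\<^sub>R green_grad z y)"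
      using integrable_scaleR_continuous_on[OF sets_sphere_measure compact_sphere \<rho> supp c1[OF z]] by simp
    then have "green_potential_grad \<rho> z \<bullet> u = (\<integral>y. (\<rho> y *\<^sub>R green_grad z y) \<bullet> u \<partial>sphere_measure)"
      unfolding green_potential_grad_def by (subst integral_inner_left) auto
    then show "(\<integral>y. \<rho> y * (green_grad z y \<bullet> u) \<partial>sphere_measure) = green_potential_grad \<rho> z \<bullet> u"
      by simp
  qed
next
  fix u :: "real^3"
  have A: "ball (0::real^3) 1 \<subseteq> cball 0 1" "ball (0::real^3) 1 \<inter> sphere 0 1 = {}" by auto
  show "continuous_on (ball 0 1) (\<lambda>x. \<integral>y. \<rho> y *\<^sub>R green_hess u x y \<partial>sphere_measure)"
    using continuous_on_kernel_integral[OF sets_sphere_measure compact_sphere \<rho> supp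
        continuous_on_green(3)[OF A(1) subset_refl A(2)]] by simp
qed

lemma green_potential_grad_radial:
  assumes \<rho>: "integrable sphere_measure \<rho>" and K: "compact K" "K \<subseteq> sphere 0 1"
    and supp: "\<And>y. y \<notin> K \<Longrightarrow> \<rho> y = 0" and x: "x \<in> cball 0 1 - K"
  shows "x \<bullet> green_potential_grad \<rho> x
    = (\<integral>y. \<rho> y * ((1 - (norm x)\<^sup>2) / norm (x - y) ^ 3 - 1) \<partial>sphere_measure)"
proof -
  have "x \<bullet> green_potential_grad \<rho> x = (\<integral>y. x \<bullet> (\<rho> y *\<^sub>R green_grad x y) \<partial>sphere_measure)"
    unfolding green_potential_grad_def
    using integrable_green(2)[OF \<rho> K supp x] by (subst integral_inner_right) auto
  also have "(\<lambda>y. x \<bullet> (\<rho> y *\<^sub>R green_grad x y))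
      = (\<lambda>y. \<rho> y * ((1 - (norm x)\<^sup>2) / norm (x - y) ^ 3 - 1))"
  proof
    fix y
    show "x \<bullet> (\<rho> y *\<^sub>R green_grad x y) = \<rho> y * ((1 - (norm x)\<^sup>2) / norm (x - y) ^ 3 - 1)"
    proof (cases "y \<in> K")
      case True
      then have "norm y = 1" "x \<noteq> y" "norm x \<le> 1" using x K by auto
      then show ?thesis using green_grad_radial[of x y] by simp
    qed (use supp in simp)
  qed
  finally show ?thesis .
qed

section \<open>Boundary behaviour of potentials\<close>

text \<open>
  The surface measure of a cap of radius \<open>t\<close> is three times the volume of the cone over it. That
  cone is a thin tube around the segment from \<open>0\<close> to \<open>u\<close>, covered by at most \<open>2 / t\<close> balls of
  radius \<open>2 t\<close> centred at equal steps \<open>t\<close> along the segment.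
\<close>
lemma sphere_measure_cap_le:
  fixes u :: "real^3"
  assumes u: "norm u = 1" and t: "0 < t" "t \<le> 1"
  shows "emeasure sphere_measure (ball u t) \<le> ennreal (64 * pi * t\<^sup>2)"
proof -
  define n where "n = nat \<lfloor>1 / t\<rfloor>"
  have cover: "{z \<in> ball 0 1. sgn z \<in> ball u t} \<subseteq> (\<Union>k\<in>{..n}. ball ((real k * t) *\<^sub>R u) (2 * t))"
  proof
    fix z assume "z \<in> {z \<in> ball 0 1. sgn z \<in> ball u t}"
    then have z: "norm z < 1" "norm (sgn z - u) < t" by (auto simp: dist_norm norm_minus_commute)
    define s where "s = norm z"
    have zs: "z = s *\<^sub>R sgn z" by (cases "z = 0") (simp_all add: s_def sgn_div_norm)
    define k where "k = nat \<lfloor>s / t\<rfloor>"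
    have s0: "0 \<le> s / t" using t by (simp add: s_def)
    have "s / t \<le> 1 / t" using z t by (intro divide_right_mono) (auto simp: s_def)
    then have kn: "k \<le> n" unfolding k_def n_def by (intro nat_mono floor_mono)
    have "real k \<le> s / t" "s / t < real k + 1" unfolding k_def using s0 by linarith+
    then have k: "real k * t \<le> s" "s < real k * t + t" using t by (auto simp: field_simps)
    have "z - (real k * t) *\<^sub>R u = s *\<^sub>R (sgn z - u) + (s - real k * t) *\<^sub>R u"
      by (subst zs) (simp add: algebra_simps)
    also have "norm \<dots> \<le> s * norm (sgn z - u) + \<bar>s - real k * t\<bar> * norm u"
      by (rule norm_triangle_le) (simp add: s_def)
    also have "\<dots> < t + t"
    proof (rule add_strict_mono)
      have "s * norm (sgn z - u) \<le> 1 * norm (sgn z - u)"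
        using z by (intro mult_right_mono) (auto simp: s_def)
      then show "s * norm (sgn z - u) < t" using z by simp
    qed (use k u in auto)
    finally have "z \<in> ball ((real k * t) *\<^sub>R u) (2 * t)" by (simp add: dist_norm norm_minus_commute)
    then show "z \<in> (\<Union>k\<in>{..n}. ball ((real k * t) *\<^sub>R u) (2 * t))" using kn by auto
  qed
  have "emeasure lborel {z \<in> ball 0 1. sgn z \<in> ball u t}
      \<le> emeasure lborel (\<Union>k\<in>{..n}. ball ((real k * t) *\<^sub>R u) (2 * t))"
    by (rule emeasure_mono[OF cover]) auto
  also have "\<dots> \<le> (\<Sum>k\<in>{..n}. emeasure lborel (ball ((real k * t) *\<^sub>R u) (2 * t)))"
    by (rule emeasure_subadditive_finite) auto
  also have "\<dots> = (\<Sum>k\<in>{..n}. ennreal (4 / 3 * pi * (2 * t) ^ 3))"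
    using t by (intro sum.cong refl, subst emeasure_ball) (auto simp: unit_ball_vol_3)
  also have "\<dots> = ennreal (real (n + 1) * (4 / 3 * pi * (2 * t) ^ 3))"
    using t by (subst sum_ennreal) (auto intro!: mult_nonneg_nonneg)
  also have "\<dots> \<le> ennreal (2 / t * (4 / 3 * pi * (2 * t) ^ 3))"
  proof (intro ennreal_leI mult_right_mono)
    have "real n \<le> 1 / t" using t by (simp add: n_def)
    moreover have "1 \<le> 1 / t" using t by simp
    ultimately show "real (n + 1) \<le> 2 / t" by simp
  qed (use t in simp)
  also have "2 / t * (4 / 3 * pi * (2 * t) ^ 3) = 64 / 3 * pi * t\<^sup>2"
    using t by (simp add: field_simps eval_nat_numeral)
  finally have "3 * emeasure lborel {z \<in> ball 0 1. sgn z \<in> ball u t} \<le> 3 * ennreal (64 / 3 * pi * t\<^sup>2)"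
    by (rule mult_left_mono) simp
  also have "\<dots> = ennreal (3 * (64 / 3 * pi * t\<^sup>2))"
    by (subst ennreal_mult) auto
  finally show ?thesis by (simp add: emeasure_sphere_measure mult.assoc)
qed

text \<open>
  A ball with arbitrary centre either misses the sphere or lies in a ball of twice the radius
  around one of its points on the sphere. For radii above 1/2 the total measure \<open>4 \<pi>\<close> is small enough.
\<close>
lemma sphere_measure_ball_le:
  fixes x :: "real^3"
  assumes t: "0 < t"
  shows "emeasure sphere_measure (ball x t) \<le> ennreal (256 * pi * t\<^sup>2)"
proof (cases "t \<le> 1 / 2")
  case small: True
  show ?thesis
  proof (cases "\<exists>u\<in>ball x t. norm u = 1")
    case True
    then obtain u where u: "u \<in> ball x t" "norm u = 1" by auto
    have "ball x t \<subseteq> ball u (2 * t)"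
    proof
      fix y assume "y \<in> ball x t"
      then show "y \<in> ball u (2 * t)"
        using u dist_triangle[of u y x] by (simp add: dist_commute)
    qed
    then have "emeasure sphere_measure (ball x t) \<le> emeasure sphere_measure (ball u (2 * t))"
      by (rule emeasure_mono) simp
    also have "\<dots> \<le> ennreal (64 * pi * (2 * t)\<^sup>2)"
      using u t small by (intro sphere_measure_cap_le) auto
    finally show ?thesis by (simp add: power_mult_distrib mult.assoc)
  next
    case False
    have "{z \<in> ball 0 1. sgn z \<in> ball x t} \<subseteq> {0}"
    proof
      fix z :: "real^3" assume "z \<in> {z \<in> ball 0 1. sgn z \<in> ball x t}"
      then have "norm (sgn z) \<noteq> 1" using False by auto
      then show "z \<in> {0}" by (auto simp: norm_sgn split: if_splits)
    qed
    then have "emeasure lborel {z \<in> ball 0 1. sgn z \<in> ball x t} \<le> emeasure lborel {0 :: real^3}"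
      by (rule emeasure_mono) simp
    then show ?thesis by (simp add: emeasure_sphere_measure)
  qed
next
  case False
  have "emeasure lborel {z \<in> ball 0 1. sgn z \<in> ball x t} \<le> emeasure lborel (ball (0::real^3) 1)"
    by (rule emeasure_mono) auto
  also have "\<dots> = ennreal (4 / 3 * pi)"
    by (subst emeasure_ball) (auto simp: unit_ball_vol_3)
  finally have "3 * emeasure lborel {z \<in> ball 0 1. sgn z \<in> ball x t} \<le> 3 * ennreal (4 / 3 * pi)"
    by (rule mult_left_mono) simp
  also have "\<dots> = ennreal (3 * (4 / 3 * pi))" by (subst ennreal_mult) auto
  also have "\<dots> \<le> ennreal (256 * pi * t\<^sup>2)"
  proof (rule ennreal_leI)
    have "(1 / 2)\<^sup>2 \<le> t\<^sup>2" using False by (intro power_mono) auto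
    then have "4 \<le> 256 * t\<^sup>2" by (simp add: power2_eq_square)
    then have "4 * pi \<le> 256 * t\<^sup>2 * pi" by (intro mult_right_mono) auto
    then show "3 * (4 / 3 * pi) \<le> 256 * pi * t\<^sup>2" by (simp add: mult_ac)
  qed
  finally show ?thesis by (simp add: emeasure_sphere_measure)
qed

lemma ball_measurable [measurable]: "ball (x :: real^3) r \<in> sets borel"
  by simp

text \<open>
  Dyadic decomposition: on the shell \<open>r / 2\<^sup>k\<^sup>+\<^sup>1 \<le> |x - y| < r / 2\<^sup>k\<close> the integrand is at most
  \<open>2\<^sup>k\<^sup>+\<^sup>1 / r\<close> while the measure is \<open>O(r\<^sup>2 / 4\<^sup>k)\<close>, so that the shells contribute a geometric series.
\<close>
lemma nn_integral_inverse_dist_centered: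
  fixes x :: "real^3"
  assumes r: "0 < r"
  shows "(\<integral>\<^sup>+y. ennreal (1 / norm (x - y)) * indicator (ball x r) y \<partial>sphere_measure)
    \<le> ennreal (1024 * pi * r)"
proof -
  let ?f = "\<lambda>k y. ennreal (2 ^ Suc k / r) * indicator (ball x (r * (1 / 2) ^ k)) y"
  have pt: "ennreal (1 / norm (x - y)) * indicator (ball x r) y \<le> (\<Sum>k. ?f k y)" for y
  proof (cases "y \<in> ball x r \<and> y \<noteq> x")
    case True
    define d where "d = norm (x - y)"
    have d: "0 < d" "d < r" using True by (auto simp: d_def dist_norm)
    obtain n where "(1 / 2) ^ n < d / r" using real_arch_pow_inv[of "d / r" "1 / 2"] d r by auto
    then have ex: "r * (1 / 2) ^ n \<le> d" using r by (simp add: field_simps)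
    define m where "m = (LEAST n. r * (1 / 2) ^ n \<le> d)"
    have m: "r * (1 / 2) ^ m \<le> d" unfolding m_def using ex by (rule LeastI)
    have "m \<noteq> 0" using m d by (intro notI) simp
    then obtain k where k: "m = Suc k" using not0_implies_Suc by blast
    have "\<not> r * (1 / 2) ^ k \<le> d"
      using not_less_Least[of k "\<lambda>n. r * (1 / 2) ^ n \<le> d"] k by (simp add: m_def)
    then have yk: "y \<in> ball x (r * (1 / 2) ^ k)" by (simp add: d_def dist_norm)
    have "1 / d \<le> 2 ^ Suc k / r"
      using m d r by (simp add: k power_one_over field_simps)
    then have "ennreal (1 / norm (x - y)) * indicator (ball x r) y \<le> ?f k y"
      using True yk by (simp add: d_def ennreal_leI)
    moreover have "F k \<le> (\<Sum>k. F k)" for F :: "nat \<Rightarrow> ennreal"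
      using sum_le_suminf[of F "{k}"] by simp
    ultimately show ?thesis by (rule order_trans)
  qed (auto simp: indicator_def)
  have "(\<integral>\<^sup>+y. ennreal (1 / norm (x - y)) * indicator (ball x r) y \<partial>sphere_measure)
      \<le> (\<integral>\<^sup>+y. (\<Sum>k. ?f k y) \<partial>sphere_measure)"
    by (intro nn_integral_mono pt)
  also have "\<dots> = (\<Sum>k. \<integral>\<^sup>+y. ?f k y \<partial>sphere_measure)"
    by (rule nn_integral_suminf) measurable
  also have "\<dots> \<le> (\<Sum>k. ennreal (512 * pi * r * (1 / 2) ^ k))"
  proof (rule suminf_le)
    fix k
    have "(\<integral>\<^sup>+y. ?f k y \<partial>sphere_measure)
        = ennreal (2 ^ Suc k / r) * emeasure sphere_measure (ball x (r * (1 / 2) ^ k))"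
      by (rule nn_integral_cmult_indicator) simp
    also have "\<dots> \<le> ennreal (2 ^ Suc k / r) * ennreal (256 * pi * (r * (1 / 2) ^ k)\<^sup>2)"
      using r by (intro mult_left_mono sphere_measure_ball_le) auto
    also have "\<dots> = ennreal (2 ^ Suc k / r * (256 * pi * (r * (1 / 2) ^ k)\<^sup>2))"
      using r by (subst ennreal_mult) auto
    also have "2 ^ Suc k / r * (256 * pi * (r * (1 / 2) ^ k)\<^sup>2) = 512 * pi * r * (1 / 2) ^ k"
      using r by (simp add: power2_eq_square power_one_over field_simps)
    finally show "(\<integral>\<^sup>+y. ?f k y \<partial>sphere_measure) \<le> ennreal (512 * pi * r * (1 / 2) ^ k)" .
  qed auto
  also have "\<dots> = ennreal (\<Sum>k. 512 * pi * r * (1 / 2) ^ k)"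
    using r by (intro suminf_ennreal2 summable_mult summable_geometric) auto
  also have "(\<Sum>k. 512 * pi * r * (1 / 2) ^ k) = 1024 * pi * r"
    by (subst suminf_mult) (auto simp: suminf_geometric summable_geometric)
  finally show ?thesis .
qed

text \<open>
  The bound is uniform in \<open>x\<close>: where \<open>y\<close> is at distance at least \<open>r\<close> from \<open>x\<close> the integrand is at
  most \<open>1 / r\<close>, and the rest is covered by the ball centred at \<open>x\<close>.
\<close>
lemma nn_integral_inverse_dist_le:
  fixes x x0 :: "real^3"
  assumes r: "0 < r"
  shows "(\<integral>\<^sup>+y. ennreal (1 / norm (x - y)) * indicator (ball x0 r) y \<partial>sphere_measure)
    \<le> ennreal (1280 * pi * r)"
proof -
  have pt: "ennreal (1 / norm (x - y)) * indicator (ball x0 r) y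
      \<le> ennreal (1 / norm (x - y)) * indicator (ball x r) y + ennreal (1 / r) * indicator (ball x0 r) y" for y
  proof (cases "y \<in> ball x r")
    case False
    then have d: "r \<le> norm (x - y)" by (simp add: dist_norm)
    then have "0 < norm (x - y)" using r by linarith
    then have "1 / norm (x - y) \<le> 1 / r" using r d by (intro divide_left_mono mult_pos_pos) auto
    then show ?thesis by (auto simp: indicator_def ennreal_leI)
  qed (auto simp: indicator_def)
  have "(\<integral>\<^sup>+y. ennreal (1 / norm (x - y)) * indicator (ball x0 r) y \<partial>sphere_measure)
      \<le> (\<integral>\<^sup>+y. ennreal (1 / norm (x - y)) * indicator (ball x r) y
            + ennreal (1 / r) * indicator (ball x0 r) y \<partial>sphere_measure)"
    by (intro nn_integral_mono pt)
  also have "\<dots> = (\<integral>\<^sup>+y. ennreal (1 / norm (x - y)) * indicator (ball x r) y \<partial>sphere_measure)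
      + (\<integral>\<^sup>+y. ennreal (1 / r) * indicator (ball x0 r) y \<partial>sphere_measure)"
    by (rule nn_integral_add) measurable
  also have "(\<integral>\<^sup>+y. ennreal (1 / r) * indicator (ball x0 r) y \<partial>sphere_measure)
      = ennreal (1 / r) * emeasure sphere_measure (ball x0 r)"
    by (rule nn_integral_cmult_indicator) simp
  also have "(\<integral>\<^sup>+y. ennreal (1 / norm (x - y)) * indicator (ball x r) y \<partial>sphere_measure)
      + ennreal (1 / r) * emeasure sphere_measure (ball x0 r)
      \<le> ennreal (1024 * pi * r) + ennreal (1 / r) * ennreal (256 * pi * r\<^sup>2)"
    using r by (intro add_mono mult_left_mono nn_integral_inverse_dist_centered sphere_measure_ball_le) auto
  also have "\<dots> = ennreal (1280 * pi * r)"
    using r by (subst ennreal_mult[symmetric]) (auto simp: ennreal_plus[symmetric] power2_eq_square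
        simp del: ennreal_plus)
  finally show ?thesis .
qed

lemma neumann_green_measurable [measurable]: "neumann_green x \<in> borel_measurable borel"
  unfolding neumann_green_def[abs_def] by measurable

lemma green_potential_small_support:
  assumes \<rho>: "\<rho> \<in> borel_measurable borel" and supp: "\<And>y. y \<notin> sphere 0 1 \<inter> ball x0 r \<Longrightarrow> \<rho> y = 0"
    and le: "\<And>y. y \<in> sphere 0 1 \<inter> ball x0 r \<Longrightarrow> \<bar>\<rho> y\<bar> \<le> B" and B: "0 \<le> B"
    and r: "0 < r" and x: "x \<in> cball 0 1"
  shows "integrable sphere_measure (\<lambda>y. \<rho> y * neumann_green x y)"
    and "\<bar>green_potential \<rho> x\<bar> \<le> 5120 * pi * r * B"
proof -
  note [measurable] = \<rho>
  have pt: "ennreal (norm (\<rho> y * neumann_green x y))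
      \<le> ennreal (4 * B) * (ennreal (1 / norm (x - y)) * indicator (ball x0 r) y)" for y
  proof (cases "y \<in> sphere 0 1 \<inter> ball x0 r")
    case True
    then have "\<bar>\<rho> y * neumann_green x y\<bar> \<le> B * (4 / norm (x - y))"
      using neumann_green_bounds[of x y] x le[OF True] B unfolding abs_mult by (intro mult_mono) auto
    then show ?thesis
      using True B by (simp add: ennreal_mult[symmetric] ennreal_leI mult.commute)
  qed (use supp in auto)
  have "(\<integral>\<^sup>+y. ennreal (norm (\<rho> y * neumann_green x y)) \<partial>sphere_measure)
      \<le> (\<integral>\<^sup>+y. ennreal (4 * B) * (ennreal (1 / norm (x - y)) * indicator (ball x0 r) y) \<partial>sphere_measure)"
    by (intro nn_integral_mono pt)
  also have "\<dots> = ennreal (4 * B)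
      * (\<integral>\<^sup>+y. ennreal (1 / norm (x - y)) * indicator (ball x0 r) y \<partial>sphere_measure)"
    by (rule nn_integral_cmult) measurable
  also have "\<dots> \<le> ennreal (4 * B) * ennreal (1280 * pi * r)"
    using r by (intro mult_left_mono nn_integral_inverse_dist_le) auto
  also have "\<dots> = ennreal (5120 * pi * r * B)"
    using r B by (simp add: ennreal_mult[symmetric] mult_ac)
  finally have le: "(\<integral>\<^sup>+y. ennreal (norm (\<rho> y * neumann_green x y)) \<partial>sphere_measure)
      \<le> ennreal (5120 * pi * r * B)" .
  show int: "integrable sphere_measure (\<lambda>y. \<rho> y * neumann_green x y)"
    unfolding integrable_iff_bounded
    using le_less_trans[OF le] by auto
  have "ennreal (norm (green_potential \<rho> x)) \<le> ennreal (5120 * pi * r * B)"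
    unfolding green_potential_def
    using integral_norm_bound_ennreal[OF int] le by (rule order_trans)
  then show "\<bar>green_potential \<rho> x\<bar> \<le> 5120 * pi * r * B"
    using r B by (simp add: ennreal_le_iff)
qed

text \<open>
  Split the charge at a small distance \<open>t\<close> from \<open>x0\<close>. The potential of the far part is continuous near
  \<open>x0\<close>, and that of the near part is \<open>O(t)\<close> uniformly on the closed ball.
\<close>
lemma green_potential_locally_bounded:
  assumes \<rho>: "integrable sphere_measure \<rho>" and supp: "\<And>y. y \<notin> sphere 0 1 \<Longrightarrow> \<rho> y = 0"
    and x0: "x0 \<in> sphere 0 1" and r: "0 < r" and le: "\<And>y. y \<in> ball x0 r \<Longrightarrow> \<bar>\<rho> y\<bar> \<le> B"
  shows "integrable sphere_measure (\<lambda>y. \<rho> y * neumann_green x0 y)"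
    and "(green_potential \<rho> \<longlongrightarrow> green_potential \<rho> x0) (at x0 within cball 0 1)"
proof -
  have [measurable]: "\<rho> \<in> borel_measurable borel"
    using borel_measurable_integrable[OF \<rho>] by simp
  define \<rho>1 where "\<rho>1 t y = \<rho> y * indicator (ball x0 t) y" for t y
  define \<rho>2 where "\<rho>2 t y = \<rho> y * indicator (- ball x0 t) y" for t y
  define B' where "B' = \<bar>B\<bar> + 1"
  have B': "B' > 0" by (simp add: B'_def)
  have sum: "\<rho> y = \<rho>1 t y + \<rho>2 t y" for t y by (simp add: \<rho>1_def \<rho>2_def indicator_def)
  have m1 [measurable]: "\<rho>1 t \<in> borel_measurable borel" for t
    unfolding \<rho>1_def[abs_def] by measurable
  have s1: "\<rho>1 t y = 0" if "y \<notin> sphere 0 1 \<inter> ball x0 t" for t y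
    using that supp by (auto simp: \<rho>1_def indicator_def)
  have b1: "\<bar>\<rho>1 t y\<bar> \<le> B'" if "t \<le> r" for t y
    using le[of y] that by (auto simp: \<rho>1_def indicator_def B'_def)
  have i2: "integrable sphere_measure (\<rho>2 t)" for t
    using integrable_mult_indicator[OF _ \<rho>, of "- ball x0 t"]
    by (simp add: \<rho>2_def[abs_def] mult.commute)
  let ?K = "\<lambda>t. sphere 0 1 - ball x0 t"
  have K: "compact (?K t)" "?K t \<subseteq> sphere 0 1" for t
    by (auto simp: compact_diff)
  have s2: "\<rho>2 t y = 0" if "y \<notin> ?K t" for t y
    using that supp by (auto simp: \<rho>2_def indicator_def)
  have small: "integrable sphere_measure (\<lambda>y. \<rho>1 t y * neumann_green x y)"
      "\<bar>green_potential (\<rho>1 t) x\<bar> \<le> 5120 * pi * t * B'"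
    if "0 < t" "t \<le> r" "x \<in> cball 0 1" for t x
    by (rule green_potential_small_support[OF m1 _ _ less_imp_le[OF B'] that(1) that(3)],
        erule s1, rule b1[OF that(2)])+
  have int: "integrable sphere_measure (\<lambda>y. \<rho>1 t y * neumann_green x y)"
      "integrable sphere_measure (\<lambda>y. \<rho>2 t y * neumann_green x y)"
      if "0 < t" "t \<le> r" "x \<in> cball 0 1 \<inter> ball x0 t" for t x
  proof -
    show "integrable sphere_measure (\<lambda>y. \<rho>1 t y * neumann_green x y)"
      using small(1)[OF that(1,2)] that(3) by simp
    have "x \<in> cball 0 1 - ?K t" using that(3) by auto
    from integrable_green(1)[OF i2 K s2 this]
    show "integrable sphere_measure (\<lambda>y. \<rho>2 t y * neumann_green x y)" .
  qed
  have eq: "green_potential \<rho> x = green_potential (\<rho>1 t) x + green_potential (\<rho>2 t) x"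
    if "0 < t" "t \<le> r" "x \<in> cball 0 1 \<inter> ball x0 t" for t x
  proof -
    have "(\<lambda>y. \<rho> y * neumann_green x y) = (\<lambda>y. \<rho>1 t y * neumann_green x y + \<rho>2 t y * neumann_green x y)"
      unfolding distrib_right[symmetric] sum[symmetric] ..
    then show ?thesis
      unfolding green_potential_def using int[OF that] by simp
  qed
  have x0': "x0 \<in> cball 0 1 \<inter> ball x0 t" if "0 < t" for t using x0 that by auto
  have "integrable sphere_measure (\<lambda>y. \<rho>1 r y * neumann_green x0 y + \<rho>2 r y * neumann_green x0 y)"
    using int[OF r order_refl x0'[OF r]] by auto
  then show "integrable sphere_measure (\<lambda>y. \<rho> y * neumann_green x0 y)"
    unfolding distrib_right[symmetric] sum[symmetric] .
  show "(green_potential \<rho> \<longlongrightarrow> green_potential \<rho> x0) (at x0 within cball 0 1)"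
  proof (rule tendstoI)
    fix e :: real assume e: "e > 0"
    \<comment> \<open>The bound \<open>5120 \<pi> t B'\<close> on the potential of the near part is then at most \<open>e / 4\<close>.\<close>
    define t where "t = min r (e / (20480 * pi * B'))"
    have t: "0 < t" "t \<le> r" using r e B' by (auto simp: t_def)
    have "t \<le> e / (20480 * pi * B')" by (simp add: t_def)
    then have te: "5120 * pi * t * B' \<le> e / 4" using B' by (simp add: field_simps)
    have U1: "\<bar>green_potential (\<rho>1 t) x\<bar> \<le> e / 4" if "x \<in> cball 0 1" for x
      using small(2)[OF t that] te by linarith
    have "x0 \<in> cball 0 1 - ?K t" using x0' t by auto
    with continuous_on_green_potential(1)[OF i2 K s2]
    have "(green_potential (\<rho>2 t) \<longlongrightarrow> green_potential (\<rho>2 t) x0) (at x0 within cball 0 1 - ?K t)"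
      unfolding continuous_on_def by blast
    moreover have "at x0 within cball 0 1 - ?K t = at x0 within cball 0 1"
      by (rule at_within_nhd[where S = "ball x0 t"]) (use t in auto)
    ultimately have "(green_potential (\<rho>2 t) \<longlongrightarrow> green_potential (\<rho>2 t) x0) (at x0 within cball 0 1)"
      by simp
    then have "\<forall>\<^sub>F x in at x0 within cball 0 1.
        dist (green_potential (\<rho>2 t) x) (green_potential (\<rho>2 t) x0) < e / 2"
      using e by (intro tendstoD) auto
    moreover have "\<forall>\<^sub>F x in at x0 within cball 0 1. x \<in> cball 0 1 \<inter> ball x0 t"
      unfolding eventually_at_topological using t by (intro exI[of _ "ball x0 t"]) auto
    ultimately show "\<forall>\<^sub>F x in at x0 within cball 0 1. dist (green_potential \<rho> x) (green_potential \<rho> x0) < e"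
    proof eventually_elim
      case (elim x)
      then have "\<bar>green_potential (\<rho>1 t) x\<bar> \<le> e / 4" "\<bar>green_potential (\<rho>1 t) x0\<bar> \<le> e / 4"
        using U1 x0 by auto
      then show ?case
        using elim(1) eq[OF t elim(2)] eq[OF t x0'[OF t(1)]] unfolding dist_real_def by linarith
    qed
  qed
qed

section \<open>A minimum principle for Neumann data\<close>

text \<open>
  In three dimensions the right-hand side is a multiple of the Dirichlet Green's function of the unit
  ball with pole \<open>a\<close>, obtained by reflecting the pole to \<open>a / |a|\<^sup>2\<close>. With \<open>A\<close> and \<open>B\<close> the two denominators,
  \<open>B\<^sup>2 - A\<^sup>2 = (1 - |a|\<^sup>2) (1 - |x|\<^sup>2)\<close>, so that it vanishes on the sphere and grows linearly
  with the distance from it.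
\<close>
lemma dirichlet_green_lower_bound:
  fixes a x :: "'a::euclidean_space"
  assumes a: "a \<noteq> 0" "norm a < 1" and x: "norm x \<le> 1" "x \<noteq> a"
  shows "(1 - (norm a)\<^sup>2) * (1 - (norm x)\<^sup>2) / 16
      \<le> 1 / norm (x - a) - 1 / (norm a * norm (x - (1 / (norm a)\<^sup>2) *\<^sub>R a))"
    and "norm x = 1 \<Longrightarrow> norm (x - a) = norm a * norm (x - (1 / (norm a)\<^sup>2) *\<^sub>R a)"
proof -
  define A where "A = norm (x - a)"
  define B where "B = norm a * norm (x - (1 / (norm a)\<^sup>2) *\<^sub>R a)"
  define q where "q = (1 - (norm a)\<^sup>2) * (1 - (norm x)\<^sup>2)"
  have A: "A > 0" using x by (simp add: A_def)
  have B0: "B \<ge> 0" by (simp add: B_def)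
  have a2: "(norm a)\<^sup>2 \<le> 1" "(norm x)\<^sup>2 \<le> 1" using a x by (simp_all add: power_le_one)
  then have q: "q \<ge> 0" by (simp add: q_def)
  have A2: "A\<^sup>2 = (norm x)\<^sup>2 - 2 * (x \<bullet> a) + (norm a)\<^sup>2"
    unfolding A_def power2_norm_eq_inner by (simp add: inner_diff_left inner_diff_right inner_commute[of a x])
  have "(norm (x - p *\<^sub>R a))\<^sup>2 = (norm x)\<^sup>2 - 2 * p * (x \<bullet> a) + p\<^sup>2 * (norm a)\<^sup>2" for p
    unfolding power2_norm_eq_inner
    by (simp add: inner_diff_left inner_diff_right inner_commute[of a x] power2_eq_square
        algebra_simps)
  then have "B\<^sup>2 = (norm a)\<^sup>2 * ((norm x)\<^sup>2 - 2 * (1 / (norm a)\<^sup>2) * (x \<bullet> a)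
      + (1 / (norm a)\<^sup>2)\<^sup>2 * (norm a)\<^sup>2)"
    unfolding B_def power_mult_distrib by simp
  also have "\<dots> = (norm a)\<^sup>2 * (norm x)\<^sup>2 - 2 * (x \<bullet> a) + 1"
  proof -
    have "n * (X - 2 * (1 / n) * Y + (1 / n)\<^sup>2 * n) = n * X - 2 * Y + 1"
      if "n \<noteq> 0" for n X Y :: real
      using that by (simp add: algebra_simps power2_eq_square)
    then show ?thesis using a by simp
  qed
  finally have B2: "B\<^sup>2 = (norm a)\<^sup>2 * (norm x)\<^sup>2 - 2 * (x \<bullet> a) + 1" .
  have BA: "B\<^sup>2 = A\<^sup>2 + q" unfolding A2 B2 q_def by (simp add: algebra_simps)
  have B: "B > 0"
    using BA A q B0 by (metis add_pos_nonneg less_eq_real_def power_zero_numeral zero_less_power less_irrefl)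
  have AB: "A \<le> B" by (rule power2_le_imp_le) (use BA q B in auto)
  have "B\<^sup>2 \<le> 2\<^sup>2"
  proof -
    have "\<bar>x \<bullet> a\<bar> \<le> norm x * norm a" by (rule Cauchy_Schwarz_ineq2)
    also have "\<dots> \<le> 1 * 1" using a x by (intro mult_mono) auto
    finally have "- (x \<bullet> a) \<le> 1" by simp
    moreover have "(norm a)\<^sup>2 * (norm x)\<^sup>2 \<le> 1" using a2 by (simp add: mult_le_one)
    ultimately show ?thesis unfolding B2 by simp
  qed
  then have B_le: "B \<le> 2" by (rule power2_le_imp_le) simp
  have "A * B * (A + B) \<le> 2 * 2 * (2 + 2)"
    using A B AB B_le by (intro mult_mono add_mono) auto
  then have "q / 16 \<le> q / (A * B * (A + B))"
    using A B q by (intro divide_left_mono) auto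
  also have "\<dots> = (B - A) * (B + A) / (A * B * (A + B))"
    using BA by (simp add: power2_eq_square algebra_simps)
  also have "\<dots> = (B - A) / (A * B)" using A B by (simp add: add.commute[of B A])
  also have "\<dots> = 1 / A - 1 / B" using A B by (simp add: field_simps)
  finally show "(1 - (norm a)\<^sup>2) * (1 - (norm x)\<^sup>2) / 16
      \<le> 1 / norm (x - a) - 1 / (norm a * norm (x - (1 / (norm a)\<^sup>2) *\<^sub>R a))"
    by (simp add: q_def A_def B_def)
  assume "norm x = 1"
  then have "B\<^sup>2 = A\<^sup>2" using BA by (simp add: q_def)
  then show "norm (x - a) = norm a * norm (x - (1 / (norm a)\<^sup>2) *\<^sub>R a)"
    using A B by (simp add: A_def B_def)
qed

text \<open>
  Hopf's boundary lemma in quantitative form: a harmonic function above \<open>m\<close> that exceeds \<open>m\<close>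
  at one point \<open>a\<close> stays above \<open>m\<close> by an amount linear in the distance to the sphere. The barrier is
  a small multiple of the Dirichlet Green's function with pole \<open>a\<close>, compared with \<open>f - m\<close> outside a
  small ball around \<open>a\<close>.
\<close>
lemma harmonic_hopf_bound:
  fixes f :: "real^3 \<Rightarrow> real"
  assumes h: "harmonic_with_gradient f g (ball 0 1)" and m: "\<And>x. x \<in> ball 0 1 \<Longrightarrow> m \<le> f x"
    and a: "a \<in> ball 0 1" "a \<noteq> 0" "m < f a"
  obtains \<eta> where "\<eta> > 0" and "\<And>x. x \<in> ball 0 1 \<Longrightarrow> m + \<eta> * (1 - (norm x)\<^sup>2) \<le> f x"
proof -
  define \<beta> where "\<beta> = (f a - m) / 2"
  have \<beta>: "\<beta> > 0" using a by (simp add: \<beta>_def)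
  have cf: "continuous_on (ball 0 1) f" by (rule harmonic_with_gradient_continuous_on[OF h])
  have "continuous (at a) f" using cf a(1) by (simp add: continuous_on_eq_continuous_at)
  then obtain r1 where r1: "r1 > 0" "\<And>x. dist x a < r1 \<Longrightarrow> dist (f x) (f a) < \<beta>"
    unfolding continuous_at_eps_delta using \<beta> by blast
  obtain r2 where r2: "r2 > 0" "cball a r2 \<subseteq> ball 0 1"
    using a(1) open_contains_cball[of "ball (0::real^3) 1"] open_ball by blast
  define r where "r = min (r1 / 2) r2"
  have r: "r > 0" "cball a r \<subseteq> ball 0 1" using r1 r2 by (auto simp: r_def)
  have near: "m + \<beta> \<le> f x" if "x \<in> cball a r" for x
  proof -
    have "dist x a < r1" using that r1(1) by (auto simp: r_def dist_commute)
    then have "\<bar>f x - f a\<bar> < \<beta>" using r1(2) by (simp add: dist_real_def)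
    moreover have "f a = m + 2 * \<beta>" by (simp add: \<beta>_def field_simps)
    ultimately show ?thesis by linarith
  qed
  define b where "b = (1 / (norm a)\<^sup>2) *\<^sub>R a"
  define w where "w x = 1 / norm (x - a) - 1 / (norm a * norm (x - b))" for x
  have na: "0 < norm a" "norm a < 1" using a by auto
  have "norm b = 1 / norm a" using na by (simp add: b_def power2_eq_square)
  also have "1 / norm a > 1" using na by simp
  finally have b: "norm b > 1" .
  have w_le: "w x \<le> 1 / norm (x - a)" for x by (simp add: w_def)
  \<comment> \<open>Around \<open>a\<close>, at distance \<open>r\<close>, the barrier \<open>k w\<close> is at most \<open>k / r = \<beta>\<close>, the gain of \<open>f\<close> there.\<close>
  define k where "k = \<beta> * r"
  have k: "k > 0" using \<beta> r by (simp add: k_def)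
  define W where "W = ball 0 1 - cball a r"
  have W: "open W" "bounded W" by (auto simp: W_def open_Diff intro: bounded_subset[OF bounded_ball])
  have "harmonic_with_gradient (\<lambda>x. 1 * (1 * f x + (- m) * 1) +
      (- k) * (1 * (1 / norm (x - a)) + (- 1 / norm a) * (1 / norm (x - b))))
      (\<lambda>x. 1 *\<^sub>R (1 *\<^sub>R g x + (- m) *\<^sub>R 0) +
      (- k) *\<^sub>R (1 *\<^sub>R newton_grad (x - a) + (- 1 / norm a) *\<^sub>R newton_grad (x - b))) W"
  proof (intro harmonic_with_gradient_lincomb harmonic_with_gradient_const)
    show "harmonic_with_gradient f g W"
      by (rule harmonic_with_gradient_subset[OF h]) (auto simp: W_def)
    have "W \<subseteq> (\<lambda>x. x + z) ` (- {0})" if "z \<notin> W" for z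
    proof
      fix x assume "x \<in> W"
      then have "x = (x - z) + z" "x - z \<in> - {0}" using that by auto
      then show "x \<in> (\<lambda>x. x + z) ` (- {0})" by blast
    qed
    note sub = harmonic_with_gradient_subset[OF harmonic_with_gradient_translate[OF harmonic_newton] this]
    show "harmonic_with_gradient (\<lambda>x. 1 / norm (x - a)) (\<lambda>x. newton_grad (x - a)) W"
      by (rule sub) (use r in \<open>auto simp: W_def\<close>)
    show "harmonic_with_gradient (\<lambda>x. 1 / norm (x - b)) (\<lambda>x. newton_grad (x - b)) W"
      by (rule sub) (use b in \<open>auto simp: W_def\<close>)
  qed
  moreover have "(\<lambda>x. 1 * (1 * f x + (- m) * 1) +
      (- k) * (1 * (1 / norm (x - a)) + (- 1 / norm a) * (1 / norm (x - b))))
      = (\<lambda>x. f x - m - k * w x)"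
    by (auto simp: w_def algebra_simps)
  ultimately have "\<exists>g'. harmonic_with_gradient (\<lambda>x. f x - m - k * w x) g' W"
    by (simp only:) (rule exI)
  then obtain g' where h': "harmonic_with_gradient (\<lambda>x. f x - m - k * w x) g' W" ..
  have W_ge: "0 \<le> f x - m - k * w x" if x: "x \<in> W" for x
  proof (rule harmonic_minimum_principle[OF h' W _ x])
    fix z and e :: real assume z: "z \<in> frontier W" and e: "e > 0"
    have "closure W \<subseteq> cball 0 1 - ball a r"
      by (rule closure_minimal) (auto simp: W_def closed_Diff)
    then have zc: "norm z \<le> 1" "r \<le> dist a z" using z by (auto simp: frontier_def)
    have zW: "z \<notin> W" using z W(1) by (simp add: frontier_def interior_open)
    show "\<exists>d>0. \<forall>x\<in>W \<inter> ball z d. - e < f x - m - k * w x"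
    \<comment> \<open>On the outer sphere the barrier tends to zero; on the inner one \<open>f\<close> is continuous.\<close>
    proof (cases "norm z = 1")
      case True
      have za: "z \<noteq> a" "z \<noteq> b" using True na b by auto
      have "w z = 0"
        using dirichlet_green_lower_bound(2)[OF a(2) na(2) _ za(1) True] True by (simp add: w_def b_def)
      have "continuous (at z) w"
        unfolding w_def using za na by (intro continuous_intros) auto
      then obtain d where d: "d > 0" "\<And>x. dist x z < d \<Longrightarrow> dist (w x) (w z) < e / k"
        unfolding continuous_at_eps_delta using e k by (meson divide_pos_pos)
      show ?thesis
      proof (intro exI[of _ d] conjI ballI d(1))
        fix x assume x: "x \<in> W \<inter> ball z d"
        then have "\<bar>w x\<bar> < e / k" using d(2)[of x] \<open>w z = 0\<close> by (simp add: dist_commute dist_real_def)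
        then have "w x < e / k" by simp
        then have "k * w x < e" using k by (simp add: field_simps)
        moreover have "m \<le> f x" using m x by (simp add: W_def)
        ultimately show "- e < f x - m - k * w x" by simp
      qed
    next
      case False
      then have zB: "z \<in> ball 0 1" using zc by simp
      then have zr: "z \<in> cball a r" using zW by (simp add: W_def)
      have za: "z \<noteq> a" "z \<noteq> b" using zc r zB b by auto
      have "k * w z \<le> k * (1 / norm (z - a))" using k w_le by (intro mult_left_mono) auto
      also have "\<dots> \<le> k * (1 / r)"
        using k r zc za
        by (intro mult_left_mono divide_left_mono mult_pos_pos) (auto simp: dist_norm norm_minus_commute)
      also have "\<dots> = \<beta>" using r by (simp add: k_def)
      finally have pos: "f z - m - k * w z \<ge> 0" using near[OF zr] by simp
      have "continuous (at z) f" using cf zB by (simp add: continuous_on_eq_continuous_at)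
      then have "continuous (at z) (\<lambda>x. f x - m - k * w x)"
        unfolding w_def using za na by (intro continuous_intros) auto
      then obtain d where d: "d > 0"
        "\<And>x. dist x z < d \<Longrightarrow> dist (f x - m - k * w x) (f z - m - k * w z) < e"
        unfolding continuous_at_eps_delta using e by blast
      show ?thesis
      proof (intro exI[of _ d] conjI ballI d(1))
        fix x assume "x \<in> W \<inter> ball z d"
        then have "dist (f x - m - k * w x) (f z - m - k * w z) < e"
          by (intro d(2)) (simp add: dist_commute)
        then show "- e < f x - m - k * w x" using pos unfolding dist_real_def by linarith
      qed
    qed
  qed
  define \<eta> where "\<eta> = min \<beta> (k * (1 - (norm a)\<^sup>2) / 16)"
  have a2: "(norm a)\<^sup>2 < 1" using na by (simp add: power_less_one_iff)
  show ?thesis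
  proof (rule that[of \<eta>])
    show "\<eta> > 0" using \<beta> k a2 by (simp add: \<eta>_def)
    fix x :: "real^3" assume x: "x \<in> ball 0 1"
    then have x2: "0 \<le> 1 - (norm x)\<^sup>2" "1 - (norm x)\<^sup>2 \<le> 1" by (auto simp: power_le_one)
    show "m + \<eta> * (1 - (norm x)\<^sup>2) \<le> f x"
    proof (cases "x \<in> cball a r")
      case True
      have "\<eta> * (1 - (norm x)\<^sup>2) \<le> \<beta> * 1" using x2 \<beta> by (intro mult_mono) (auto simp: \<eta>_def)
      then show ?thesis using near[OF True] by simp
    next
      case False
      then have xW: "x \<in> W" and xa: "x \<noteq> a" using x r by (auto simp: W_def)
      have "\<eta> * (1 - (norm x)\<^sup>2) \<le> k * (1 - (norm a)\<^sup>2) / 16 * (1 - (norm x)\<^sup>2)"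
        using x2 by (intro mult_right_mono) (auto simp: \<eta>_def)
      also have "\<dots> = k * ((1 - (norm a)\<^sup>2) * (1 - (norm x)\<^sup>2) / 16)" by simp
      also have "\<dots> \<le> k * w x"
        unfolding w_def b_def using x k
        by (intro mult_left_mono dirichlet_green_lower_bound(1)[OF a(2) na(2) _ xa]) auto
      finally show ?thesis using W_ge[OF xW] by simp
    qed
  qed
qed

text \<open>
  Suppose the infimum \<open>m\<close> of \<open>f\<close> over the open ball were below \<open>c\<close>. Hopf's bound gives
  \<open>f \<ge> m + \<eta> (1 - |x|\<^sup>2)\<close>, a gain of order \<open>1 - s\<close> on the sphere of radius \<open>s\<close>. Going from there
  radially outwards, away from \<open>K\<close>, the flux hypothesis allows a loss of order \<open>(1 - s)\<^sup>2\<close> only. For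
  \<open>s\<close> close to 1 the gain wins, so \<open>f\<close> stays uniformly above \<open>m\<close>, contradicting the choice of \<open>m\<close>.
  The argument takes place in the open ball, so that \<open>f\<close> may behave wildly at the boundary
  away from \<open>K\<close>.
\<close>
lemma neumann_minimum_principle:
  fixes f :: "real^3 \<Rightarrow> real"
  assumes h: "harmonic_with_gradient f g (ball 0 1)"
    and K: "K \<subseteq> sphere 0 1" "K \<noteq> {}" and d: "0 < d" and C: "0 \<le> C"
    and near: "\<And>x. x \<in> ball 0 1 \<Longrightarrow> infdist x K < d \<Longrightarrow> c \<le> f x"
    and flux: "\<And>x. x \<in> ball 0 1 \<Longrightarrow> d / 2 \<le> infdist x K \<Longrightarrow> - C * (1 - (norm x)\<^sup>2) \<le> x \<bullet> g x"
    and x: "x \<in> ball 0 1"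
  shows "c \<le> f x"
proof (rule ccontr)
  assume notc: "\<not> c \<le> f x"
  define s0 where "s0 = max (1 / 2) (1 - d / 2)"
  have s0: "1 / 2 \<le> s0" "1 - d / 2 \<le> s0" "s0 < 1" using d by (auto simp: s0_def)
  have radial: "f (s *\<^sub>R sgn y) - 4 * C * (1 - s)\<^sup>2 \<le> f y"
    if s: "s0 \<le> s" and y: "y \<in> ball 0 1" "s \<le> norm y" "d \<le> infdist y K" for s y
  proof -
    define t where "t = norm y"
    define u where "u = sgn y"
    have s2: "1 / 2 \<le> s" "1 - d / 2 \<le> s" using s s0 by auto
    have t: "s \<le> t" "t < 1" using y by (auto simp: t_def)
    have "y \<noteq> 0" using y s2 by auto
    then have u: "norm u = 1" and yu: "y = t *\<^sub>R u" by (simp_all add: u_def t_def norm_sgn sgn_div_norm)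
    show ?thesis
    proof (cases "s = t")
      case True
      then show ?thesis using C yu by (simp add: u_def)
    next
      case False
      then have st: "s < t" using t by simp
      have inb: "\<tau> *\<^sub>R u \<in> ball 0 1" if "s \<le> \<tau>" "\<tau> \<le> t" for \<tau> using that s2 t u by simp
      have D: "DERIV (\<lambda>\<tau>. f (\<tau> *\<^sub>R u)) \<tau> :> g (\<tau> *\<^sub>R u) \<bullet> u" if "s \<le> \<tau>" "\<tau> \<le> t" for \<tau>
      proof -
        have l: "((\<lambda>\<tau>. \<tau> *\<^sub>R u) has_derivative (\<lambda>h. h *\<^sub>R u)) (at \<tau>)"
          by (auto intro!: derivative_eq_intros)
        show ?thesis
          unfolding has_field_derivative_def
          by (rule has_derivative_eq_rhs[OF has_derivative_compose[OF l
                  harmonic_with_gradient_has_derivative[OF h inb[OF that]]]])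
            (auto simp: mult.commute)
      qed
      obtain \<xi> where \<xi>: "s < \<xi>" "\<xi> < t"
        and eq: "f (t *\<^sub>R u) - f (s *\<^sub>R u) = (t - s) * (g (\<xi> *\<^sub>R u) \<bullet> u)"
        using MVT2[OF st D] by blast
      have "infdist y K \<le> infdist (\<xi> *\<^sub>R u) K + dist y (\<xi> *\<^sub>R u)" by (rule infdist_triangle)
      also have "dist y (\<xi> *\<^sub>R u) = t - \<xi>"
        using \<xi> u by (simp add: yu dist_norm scaleR_diff_left[symmetric])
      finally have "d / 2 \<le> infdist (\<xi> *\<^sub>R u) K" using y(3) \<xi> t s2 by simp
      from flux[OF inb this] have "- C * (1 - \<xi>\<^sup>2) \<le> \<xi> * (g (\<xi> *\<^sub>R u) \<bullet> u)"
        using \<xi> u s2 by (simp add: inner_commute)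
      moreover have "- (C * (1 - \<xi>\<^sup>2)) \<ge> - (\<xi> * (4 * C * (1 - s)))"
      proof -
        have "1 - \<xi>\<^sup>2 = (1 - \<xi>) * (1 + \<xi>)" by (simp add: power2_eq_square algebra_simps)
        also have "\<dots> \<le> (1 - s) * 2" using \<xi> t s2 by (intro mult_mono) auto
        also have "\<dots> \<le> (1 - s) * (4 * \<xi>)" using \<xi> t s2 by (intro mult_left_mono) auto
        finally have "C * (1 - \<xi>\<^sup>2) \<le> C * ((1 - s) * (4 * \<xi>))" using C by (rule mult_left_mono)
        then show ?thesis by (simp add: mult_ac)
      qed
      ultimately have "\<xi> * (- (4 * C * (1 - s))) \<le> \<xi> * (g (\<xi> *\<^sub>R u) \<bullet> u)" by simp
      then have "- (4 * C * (1 - s)) \<le> g (\<xi> *\<^sub>R u) \<bullet> u"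
        using \<xi> s2 by (simp only: mult_le_cancel_left_pos)
      then have "(t - s) * (- (4 * C * (1 - s))) \<le> (t - s) * (g (\<xi> *\<^sub>R u) \<bullet> u)"
        using st by (intro mult_left_mono) auto
      moreover have "(t - s) * (4 * C * (1 - s)) \<le> (1 - s) * (4 * C * (1 - s))"
        using C st t by (intro mult_right_mono) auto
      moreover have "f y = f (t *\<^sub>R u)" using yu by simp
      moreover have "4 * C * (1 - s)\<^sup>2 = (1 - s) * (4 * C * (1 - s))" by (simp add: power2_eq_square)
      ultimately show ?thesis
        using eq unfolding u_def[symmetric] by linarith
    qed
  qed
  have sph: "s *\<^sub>R sgn y \<in> cball 0 s" if "0 \<le> s" for s and y :: "real^3"
    using that by (simp add: norm_sgn)
  have cf: "continuous_on (ball 0 1) f" by (rule harmonic_with_gradient_continuous_on[OF h])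
  have "continuous_on (cball 0 s0) f" by (rule continuous_on_subset[OF cf]) (use s0 in auto)
  moreover have "cball (0::real^3) s0 \<noteq> {}" using s0 by simp
  ultimately obtain z where z: "\<And>y. y \<in> cball 0 s0 \<Longrightarrow> f z \<le> f y"
    using continuous_attains_inf[OF compact_cball] by metis
  have lower: "min c (f z - 4 * C * (1 - s0)\<^sup>2) \<le> f y" if y: "y \<in> ball 0 1" for y
  proof (cases "infdist y K < d \<or> norm y \<le> s0")
    case True
    moreover have "0 \<le> 4 * C * (1 - s0)\<^sup>2" using C by simp
    ultimately show ?thesis using near[OF y] z[of y] by (auto simp: min_le_iff_disj)
  next
    case False
    then have "f (s0 *\<^sub>R sgn y) - 4 * C * (1 - s0)\<^sup>2 \<le> f y" using radial[of s0 y] y by simp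
    then show ?thesis using z[OF sph[of s0 y]] s0 by simp
  qed
  define m where "m = Inf (f ` ball 0 1)"
  have bdd: "bdd_below (f ` ball 0 1)" using lower by (auto intro!: bdd_belowI)
  have m: "m \<le> f y" if "y \<in> ball 0 1" for y
    unfolding m_def by (rule cInf_lower[OF imageI[OF that] bdd])
  have mc: "m < c" using m[OF x] notc by simp
  obtain p where p: "p \<in> K" using K by auto
  then have np: "norm p = 1" using K by auto
  \<comment> \<open>A point of the ball so close to \<open>K\<close> that \<open>f a \<ge> c > m\<close>, and different from the origin.\<close>
  define a where "a = (1 - min d 1 / 2) *\<^sub>R p"
  have na: "norm a = 1 - min d 1 / 2" using d np by (simp add: a_def)
  then have aB: "a \<in> ball 0 1" "a \<noteq> 0" using d by auto
  have "infdist a K \<le> dist a p" by (rule infdist_le[OF p])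
  also have "dist a p = norm ((- (min d 1 / 2)) *\<^sub>R p)"
    by (simp add: a_def dist_norm algebra_simps)
  also have "\<dots> < d" using d np by simp
  finally have "m < f a" using near[OF aB(1)] mc by simp
  from harmonic_hopf_bound[OF h m aB this] obtain \<eta> where \<eta>: "\<eta> > 0"
    and hopf: "\<And>y. y \<in> ball 0 1 \<Longrightarrow> m + \<eta> * (1 - (norm y)\<^sup>2) \<le> f y" by metis
  \<comment> \<open>Chosen so that the quadratic loss \<open>4 C (1 - s)\<^sup>2\<close> is at most half of the linear gain \<open>\<eta> (1 - s)\<close>.\<close>
  define s where "s = max s0 (1 - \<eta> / (8 * C + 1))"
  have "0 < \<eta> / (8 * C + 1)" using \<eta> C by simp
  then have s: "s0 \<le> s" "s < 1" "1 - s \<le> \<eta> / (8 * C + 1)" using s0 by (auto simp: s_def)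
  have "8 * C * (1 - s) \<le> (8 * C + 1) * (1 - s)" using s by (intro mult_right_mono) auto
  also have "\<dots> \<le> \<eta>" using s(3) C by (simp add: field_simps)
  finally have Cs: "4 * C * (1 - s) \<le> \<eta> / 2" by simp
  define \<theta> where "\<theta> = \<eta> / 2 * (1 - s)"
  have \<theta>: "\<theta> > 0" using \<eta> s by (simp add: \<theta>_def)
  have inner: "m + 2 * \<theta> \<le> f y" if "norm y \<le> s" for y
  proof -
    have "(norm y)\<^sup>2 \<le> s\<^sup>2" using that by (simp add: power_mono)
    also have "s\<^sup>2 \<le> s" using s s0 by (simp add: power2_eq_square mult_left_le)
    finally have "\<eta> * (1 - s) \<le> \<eta> * (1 - (norm y)\<^sup>2)" using \<eta> by (intro mult_left_mono) auto
    then show ?thesis using hopf[of y] that s by (simp add: \<theta>_def)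
  qed
  have "min c (m + \<theta>) \<le> f y" if y: "y \<in> ball 0 1" for y
  proof (cases "infdist y K < d \<or> norm y \<le> s")
    case True
    then show ?thesis using near[OF y] inner[of y] \<theta> by auto
  next
    case False
    then have "f (s *\<^sub>R sgn y) - 4 * C * (1 - s)\<^sup>2 \<le> f y" using radial[OF s(1) y] by simp
    moreover have "m + 2 * \<theta> \<le> f (s *\<^sub>R sgn y)"
      using sph[of s y] s s0 by (intro inner) simp
    moreover have "4 * C * (1 - s)\<^sup>2 \<le> \<theta>"
      using mult_right_mono[OF Cs, of "1 - s"] s by (simp add: \<theta>_def power2_eq_square mult_ac)
    ultimately show ?thesis by simp
  qed
  then have "min c (m + \<theta>) \<le> m"
    unfolding m_def by (intro cInf_greatest) auto
  then show False using mc \<theta> by simp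
qed

section \<open>The total charge does not vanish\<close>

text \<open>
  The domination principle for the Neumann problem. For a neutral charge the constant \<open>-1\<close> in
  the radial identity integrates to zero, and what remains is the Poisson integral of \<open>\<mu>\<close>. Away
  from \<open>K\<close> the Poisson kernel of the points of \<open>K\<close> is at most a multiple of \<open>1 - |x|\<^sup>2\<close>, while all other
  charge is nonnegative: this is the flux condition of the minimum principle. At the centre the
  potential of a neutral charge is zero.
\<close>
lemma neutral_potential_min_nonpos:
  assumes \<mu>: "integrable sphere_measure \<mu>" and supp: "\<And>y. y \<notin> sphere 0 1 \<Longrightarrow> \<mu> y = 0"
    and K: "compact K" "K \<subseteq> sphere 0 1" "K \<noteq> {}" and nonneg: "\<And>y. y \<notin> K \<Longrightarrow> 0 \<le> \<mu> y"
    and neutral: "(\<integral>y. \<mu> y \<partial>sphere_measure) = 0"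
    and bounded: "\<And>p. p \<in> K \<Longrightarrow> \<exists>r>0. \<exists>B. \<forall>y\<in>ball p r. \<bar>\<mu> y\<bar> \<le> B"
    and ge: "\<And>p. p \<in> K \<Longrightarrow> c \<le> green_potential \<mu> p"
  shows "c \<le> 0"
proof (rule ccontr)
  assume "\<not> c \<le> 0"
  then have c: "c > 0" by simp
  let ?U = "green_potential \<mu>"
  have "\<exists>d>0. \<forall>x\<in>cball 0 1. x \<noteq> p \<and> dist x p < d \<longrightarrow> c / 2 < ?U x" if p: "p \<in> K" for p
  proof -
    obtain r B where "r > 0" "\<And>y. y \<in> ball p r \<Longrightarrow> \<bar>\<mu> y\<bar> \<le> B" using bounded[OF p] by blast
    from green_potential_locally_bounded(2)[OF \<mu> supp _ this, of p]
    have lim: "(?U \<longlongrightarrow> ?U p) (at p within cball 0 1)" using p K(2) by auto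
    have "c / 2 < ?U p" using ge[OF p] c by simp
    from order_tendstoD(1)[OF lim this] show ?thesis unfolding eventually_at by auto
  qed
  then obtain d where d: "\<And>p. p \<in> K \<Longrightarrow> d p > 0"
    and Ud: "\<And>p x. \<lbrakk>p \<in> K; x \<in> cball 0 1; x \<noteq> p; dist x p < d p\<rbrakk> \<Longrightarrow> c / 2 < ?U x" by metis
  have "open (\<Union>p\<in>K. ball p (d p))" "K \<subseteq> (\<Union>p\<in>K. ball p (d p))" using d by auto
  from compact_in_open_separated[OF K(3,1) this] obtain e where e: "e > 0"
    and sub: "{x. infdist x K \<le> e} \<subseteq> (\<Union>p\<in>K. ball p (d p))" by metis
  define C where "C = (\<integral>y. \<bar>\<mu> y\<bar> \<partial>sphere_measure) / (e / 2) ^ 3"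
  have C: "0 \<le> C" using e by (simp add: C_def)
  have "c / 2 \<le> ?U 0"
  proof (rule neumann_minimum_principle[OF harmonic_green_potential[OF \<mu> supp] K(2,3) e C])
    fix x :: "real^3" assume x: "x \<in> ball 0 1" "infdist x K < e"
    then obtain p where p: "p \<in> K" "dist p x < d p" using sub by force
    then have "x \<noteq> p" using x K(2) by auto
    then show "c / 2 \<le> ?U x" using Ud[OF p(1), of x] p x by (simp add: dist_commute)
  next
    fix x :: "real^3" assume x: "x \<in> ball 0 1" "e / 2 \<le> infdist x K"
    let ?P = "\<lambda>y. (1 - (norm x)\<^sup>2) / norm (x - y) ^ 3"
    have x2: "0 \<le> 1 - (norm x)\<^sup>2" using x by (simp add: power_le_one)
    have "continuous_on (sphere 0 1) ?P" using x by (intro continuous_intros) auto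
    from integrable_scaleR_continuous_on[OF sets_sphere_measure compact_sphere \<mu> supp this]
    have int: "integrable sphere_measure (\<lambda>y. \<mu> y * ?P y)" by simp
    have "- C * (1 - (norm x)\<^sup>2) = (\<integral>y. - (1 - (norm x)\<^sup>2) / (e / 2) ^ 3 * \<bar>\<mu> y\<bar> \<partial>sphere_measure)"
    proof -
      have "- (J / E) * n = - n / E * J" for J E n :: real by (simp add: mult.commute)
      then show ?thesis unfolding integral_mult_right_zero C_def .
    qed
    also have "\<dots> \<le> (\<integral>y. \<mu> y * ?P y \<partial>sphere_measure)"
    proof (rule integral_mono[OF _ int])
      show "integrable sphere_measure (\<lambda>y. - (1 - (norm x)\<^sup>2) / (e / 2) ^ 3 * \<bar>\<mu> y\<bar>)"
        using \<mu> by (intro integrable_mult_right integrable_abs)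
      fix y
      have P0: "0 \<le> ?P y" using x2 by simp
      show "- (1 - (norm x)\<^sup>2) / (e / 2) ^ 3 * \<bar>\<mu> y\<bar> \<le> \<mu> y * ?P y"
      proof (cases "y \<in> K")
        case True
        have "e / 2 \<le> dist x y" using x infdist_le[OF True, of x] by linarith
        then have "(e / 2) ^ 3 \<le> norm (x - y) ^ 3" using e by (intro power_mono) (auto simp: dist_norm)
        moreover have "0 < (e / 2) ^ 3" using e by simp
        ultimately have "?P y \<le> (1 - (norm x)\<^sup>2) / (e / 2) ^ 3"
          using x2 by (intro divide_left_mono mult_pos_pos) auto
        then have "\<bar>\<mu> y\<bar> * ?P y \<le> \<bar>\<mu> y\<bar> * ((1 - (norm x)\<^sup>2) / (e / 2) ^ 3)"
          by (rule mult_left_mono) simp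
        moreover have "- (\<bar>\<mu> y\<bar> * ?P y) \<le> \<mu> y * ?P y"
          using mult_right_mono[of "- \<bar>\<mu> y\<bar>" "\<mu> y", OF _ P0] by simp
        moreover have "- (1 - (norm x)\<^sup>2) / (e / 2) ^ 3 * \<bar>\<mu> y\<bar>
            = - (\<bar>\<mu> y\<bar> * ((1 - (norm x)\<^sup>2) / (e / 2) ^ 3))"
        proof -
          have "- n / E * J = - (J * (n / E))" for J E n :: real by (simp add: mult.commute)
          then show ?thesis .
        qed
        ultimately show ?thesis by linarith
      next
        case False
        have "0 \<le> \<mu> y * ?P y" using nonneg[OF False] P0 by (rule mult_nonneg_nonneg)
        moreover have "- (1 - (norm x)\<^sup>2) / (e / 2) ^ 3 * \<bar>\<mu> y\<bar> \<le> 0"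
          using x2 e by (intro mult_nonpos_nonneg divide_nonpos_nonneg) auto
        ultimately show ?thesis by linarith
      qed
    qed
    also have "\<dots> = (\<integral>y. \<mu> y * ?P y - \<mu> y \<partial>sphere_measure)"
      using int \<mu> neutral by simp
    also have "\<dots> = x \<bullet> green_potential_grad \<mu> x"
      using green_potential_grad_radial[OF \<mu> compact_sphere subset_refl supp, of x] x
      by (simp add: right_diff_distrib)
    finally show "- C * (1 - (norm x)\<^sup>2) \<le> x \<bullet> green_potential_grad \<mu> x" .
  qed simp_all
  moreover have "?U 0 = (\<integral>y. 2 * \<mu> y \<partial>sphere_measure)"
    unfolding green_potential_def
  proof (rule Bochner_Integration.integral_cong[OF refl])
    fix y show "\<mu> y * neumann_green 0 y = 2 * \<mu> y"
      using neumann_green_0[of y] supp[of y] by (cases "y \<in> sphere 0 1") auto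
  qed
  ultimately show False using c neutral by simp
qed

text \<open>
  The competitor for the domination principle is built from the decomposition of \<open>\<rho>\<close> into its
  positive part and its negative part \<open>neg\<close>. Only the piece \<open>trunc n\<close> of the negative part on a compact
  set is kept; the lost charge \<open>\<delta>\<close> tends to zero and is replaced by a multiple of one fixed bounded
  piece \<open>trunc n0\<close>. Dropping negative charge only raises the potential, and the replacement lowers it
  by at most \<open>\<delta> / T * M \<le> 1/2\<close>.
\<close>
lemma total_charge_nonzero:
  assumes Q: "open Q" and \<Gamma>: "\<Gamma> = sphere 0 1 \<inter> Q" "\<Gamma> \<noteq> {}"
    and \<rho>: "integrable sphere_measure \<rho>" and supp: "\<And>y. y \<notin> \<Gamma> \<Longrightarrow> \<rho> y = 0"
    and bounded: "\<And>p. p \<in> \<Gamma> \<Longrightarrow> \<exists>r>0. \<exists>B. \<forall>y\<in>ball p r. \<bar>\<rho> y\<bar> \<le> B"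
    and eq: "\<And>x. x \<in> \<Gamma> \<Longrightarrow> green_potential \<rho> x = 1"
  shows "(\<integral>y. \<rho> y \<partial>sphere_measure) \<noteq> 0"
proof
  assume I0: "(\<integral>y. \<rho> y \<partial>sphere_measure) = 0"
  let ?S = "sphere_measure"
  have [measurable]: "\<rho> \<in> borel_measurable borel"
    using borel_measurable_integrable[OF \<rho>] by simp
  have suppS: "\<rho> y = 0" if "y \<notin> sphere 0 1" for y using that supp \<Gamma> by auto
  define neg where "neg y = max 0 (- \<rho> y)" for y
  have neg: "0 \<le> neg y" "neg y \<le> \<bar>\<rho> y\<bar>" "0 \<le> \<rho> y + neg y" for y by (auto simp: neg_def)
  have [measurable]: "neg \<in> borel_measurable borel" unfolding neg_def[abs_def] by measurable
  have ineg: "integrable ?S neg"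
    by (rule Bochner_Integration.integrable_bound[OF \<rho>]) (use neg in auto)
  obtain x1 where x1: "x1 \<in> \<Gamma>" using \<Gamma>(2) by blast
  \<comment> \<open>A neutral charge without negative part is zero, and so is its potential.\<close>
  have neg_pos: "(\<integral>y. neg y \<partial>?S) \<noteq> 0"
  proof
    assume "(\<integral>y. neg y \<partial>?S) = 0"
    then have "AE y in ?S. neg y = 0"
      using integral_nonneg_eq_0_iff_AE[OF ineg] neg by auto
    then have "AE y in ?S. 0 \<le> \<rho> y" by eventually_elim (auto simp: neg_def max_def split: if_splits)
    then have "AE y in ?S. \<rho> y = 0"
      using integral_nonneg_eq_0_iff_AE[OF \<rho>] I0 by auto
    then have "AE y in ?S. \<rho> y * neumann_green x1 y = 0" by eventually_elim simp
    then have "green_potential \<rho> x1 = 0"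
      unfolding green_potential_def by (rule integral_eq_zero_AE)
    then show False using eq[OF x1] by simp
  qed
  obtain C :: "nat \<Rightarrow> (real^3) set" where C: "\<And>n. compact (C n)" "\<And>n. C n \<subseteq> Q"
    and exhaust: "\<And>K. compact K \<Longrightarrow> K \<subseteq> Q \<Longrightarrow> \<exists>N. \<forall>n\<ge>N. K \<subseteq> C n"
    by (rule open_Union_compact_subsets[OF Q]) blast
  define L where "L n = sphere 0 1 \<inter> C n" for n
  have L: "compact (L n)" "L n \<subseteq> \<Gamma>" "L n \<subseteq> sphere 0 1" for n
    using C by (auto simp: L_def \<Gamma> intro: compact_Int)
  have [measurable]: "L n \<in> sets borel" for n using L(1) by (simp add: borel_compact)
  define trunc where "trunc n y = neg y * indicator (L n) y" for n y
  have trunc: "0 \<le> trunc n y" "trunc n y \<le> neg y" for n y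
    using neg by (auto simp: trunc_def indicator_def)
  have [measurable]: "trunc n \<in> borel_measurable borel" for n
    unfolding trunc_def[abs_def] by measurable
  have itrunc: "integrable ?S (trunc n)" for n
    by (rule Bochner_Integration.integrable_bound[OF ineg]) (use neg trunc in auto)
  have lim: "(\<lambda>n. \<integral>y. trunc n y \<partial>?S) \<longlonglongrightarrow> (\<integral>y. neg y \<partial>?S)"
  proof (rule integral_dominated_convergence[OF _ _ ineg])
    show "AE y in ?S. (\<lambda>n. trunc n y) \<longlonglongrightarrow> neg y"
    proof (rule AE_I2)
      fix y
      show "(\<lambda>n. trunc n y) \<longlonglongrightarrow> neg y"
      proof (cases "y \<in> \<Gamma>")
        case True
        then obtain N where "\<forall>n\<ge>N. {y} \<subseteq> C n" using exhaust[of "{y}"] \<Gamma> by auto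
        then have "\<forall>\<^sub>F n in sequentially. trunc n y = neg y"
          using True \<Gamma> unfolding eventually_sequentially
          by (intro exI[of _ N]) (auto simp: trunc_def L_def)
        then show ?thesis by (rule tendsto_eventually)
      next
        case False
        then have "trunc n y = neg y" for n using supp by (simp add: trunc_def neg_def)
        then show ?thesis by simp
      qed
    qed
    show "AE y in ?S. norm (trunc n y) \<le> neg y" for n using trunc by simp
  qed measurable
  have "\<exists>n0. (\<integral>y. trunc n0 y \<partial>?S) \<noteq> 0"
  proof (rule ccontr)
    assume "\<nexists>n0. (\<integral>y. trunc n0 y \<partial>?S) \<noteq> 0"
    then have "(\<lambda>n. 0) \<longlonglongrightarrow> (\<integral>y. neg y \<partial>?S)" using lim by simp
    then show False using neg_pos LIMSEQ_const_iff by metis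
  qed
  then obtain n0 where n0: "(\<integral>y. trunc n0 y \<partial>?S) \<noteq> 0" ..
  define T where "T = (\<integral>y. trunc n0 y \<partial>?S)"
  have T: "T > 0" using n0 trunc by (simp add: T_def order_less_le)
  have "L n0 \<noteq> {}"
  proof
    assume "L n0 = {}"
    then have "trunc n0 = (\<lambda>y. 0)" by (auto simp: trunc_def)
    then show False using n0 by simp
  qed
  have "\<exists>B. \<forall>y\<in>L n0. \<bar>\<rho> y\<bar> \<le> B"
  proof -
    obtain r B where rB: "\<And>p. p \<in> \<Gamma> \<Longrightarrow> r p > 0" "\<And>p y. p \<in> \<Gamma> \<Longrightarrow> y \<in> ball p (r p) \<Longrightarrow> \<bar>\<rho> y\<bar> \<le> B p"
      using bounded by metis
    have "L n0 \<subseteq> (\<Union>p\<in>L n0. ball p (r p))" using rB(1) L(2) by force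
    then obtain D where D: "D \<subseteq> L n0" "finite D" "L n0 \<subseteq> (\<Union>p\<in>D. ball p (r p))"
      using compactE_image[OF L(1)[of n0], of "L n0" "\<lambda>p. ball p (r p)"] by auto
    show ?thesis
    proof (intro exI[of _ "\<Sum>p\<in>D. \<bar>B p\<bar>"] ballI)
      fix y assume "y \<in> L n0"
      then obtain p where p: "p \<in> D" "y \<in> ball p (r p)" using D by auto
      then have "\<bar>\<rho> y\<bar> \<le> B p" using rB(2)[of p y] D(1) L(2) by auto
      also have "B p \<le> \<bar>B p\<bar>" by simp
      also have "\<dots> \<le> (\<Sum>p\<in>D. \<bar>B p\<bar>)" using D(2) p(1) by (intro member_le_sum) auto
      finally show "\<bar>\<rho> y\<bar> \<le> (\<Sum>p\<in>D. \<bar>B p\<bar>)" .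
    qed
  qed
  then obtain B where B: "\<And>y. y \<in> L n0 \<Longrightarrow> \<bar>\<rho> y\<bar> \<le> B" by auto
  \<comment> \<open>The factor 2 is the radius of a ball around the origin that contains the sphere.\<close>
  define M where "M = 5120 * pi * 2 * \<bar>B\<bar>"
  have M0: "0 \<le> M" by (simp add: M_def)
  have tau: "integrable ?S (\<lambda>y. trunc n0 y * neumann_green x y)" "\<bar>green_potential (trunc n0) x\<bar> \<le> M"
    if x: "x \<in> cball 0 1" for x
  proof -
    have s: "trunc n0 y = 0" if "y \<notin> sphere 0 1 \<inter> ball 0 2" for y
    proof -
      have "y \<notin> L n0" using that L(3)[of n0] by force
      then show ?thesis by (simp add: trunc_def)
    qed
    have b: "\<bar>trunc n0 y\<bar> \<le> \<bar>B\<bar>" for y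
      using B[of y] neg[of y] by (auto simp: trunc_def indicator_def)
    have m: "trunc n0 \<in> borel_measurable borel" by measurable
    note small = green_potential_small_support[of "trunc n0" 0 2 "\<bar>B\<bar>" x, OF m s b abs_ge_zero _ x]
    show "integrable ?S (\<lambda>y. trunc n0 y * neumann_green x y)" by (rule small(1)) simp_all
    show "\<bar>green_potential (trunc n0) x\<bar> \<le> M" unfolding M_def by (rule small(2)) simp_all
  qed
  have "T / (2 * (M + 1)) > 0" using T M0 by simp
  from LIMSEQ_D[OF lim this] obtain n where
    n: "\<bar>(\<integral>y. trunc n y \<partial>?S) - (\<integral>y. neg y \<partial>?S)\<bar> < T / (2 * (M + 1))" by auto
  define \<delta> where "\<delta> = (\<integral>y. neg y \<partial>?S) - (\<integral>y. trunc n y \<partial>?S)"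
  have "(\<integral>y. trunc n y \<partial>?S) \<le> (\<integral>y. neg y \<partial>?S)"
    by (rule integral_mono[OF itrunc ineg trunc(2)])
  then have \<delta>0: "0 \<le> \<delta>" by (simp add: \<delta>_def)
  have "\<delta> < T / (2 * (M + 1))" using n unfolding \<delta>_def by linarith
  then have "\<delta> * (2 * (M + 1)) < T" using M0 by (subst (asm) pos_less_divide_eq) auto
  then have "2 * (\<delta> * M) \<le> T" using \<delta>0 by (simp add: algebra_simps)
  then have \<delta>M: "\<delta> / T * M \<le> 1 / 2" using T by (simp add: field_simps)
  define lost where "lost y = neg y - trunc n y" for y
  have lost: "0 \<le> lost y" "lost y \<le> \<bar>\<rho> y\<bar>" for y
    using trunc[of n y] neg[of y] by (auto simp: lost_def)
  have ilost: "integrable ?S lost" unfolding lost_def[abs_def] using ineg itrunc by auto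
  define \<mu> where "\<mu> y = \<rho> y + lost y - \<delta> / T * trunc n0 y" for y
  define K where "K = L n \<union> L n0"
  have K: "compact K" "K \<subseteq> sphere 0 1" "K \<noteq> {}" "K \<subseteq> \<Gamma>"
    using L \<open>L n0 \<noteq> {}\<close> by (auto simp: K_def)
  have "(1 / 2 :: real) \<le> 0"
  proof (rule neutral_potential_min_nonpos[OF _ _ K(1-3)])
    show "integrable ?S \<mu>" unfolding \<mu>_def[abs_def] using \<rho> ilost itrunc by auto
    show "\<mu> y = 0" if "y \<notin> sphere 0 1" for y
      using suppS[OF that] by (simp add: \<mu>_def lost_def trunc_def neg_def)
    show "0 \<le> \<mu> y" if "y \<notin> K" for y
      using that neg(3)[of y] by (simp add: \<mu>_def K_def lost_def trunc_def)
    show "(\<integral>y. \<mu> y \<partial>?S) = 0"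
      unfolding \<mu>_def lost_def using \<rho> ineg itrunc I0 T
      by (simp add: T_def[symmetric] \<delta>_def)
  next
    fix p assume p: "p \<in> K"
    obtain r B where r: "r > 0" and rB: "\<And>y. y \<in> ball p r \<Longrightarrow> \<bar>\<rho> y\<bar> \<le> B"
      using bounded[of p] p K(4) by blast
    have "\<bar>\<mu> y\<bar> \<le> (2 + \<delta> / T) * B" if "y \<in> ball p r" for y
    proof -
      have "\<bar>\<mu> y\<bar> \<le> \<bar>\<rho> y\<bar> + \<bar>lost y\<bar> + \<bar>\<delta> / T * trunc n0 y\<bar>"
        unfolding \<mu>_def by linarith
      also have "\<dots> \<le> B + B + \<delta> / T * B"
      proof (intro add_mono)
        show "\<bar>\<rho> y\<bar> \<le> B" using rB[OF that] .
        show "\<bar>lost y\<bar> \<le> B" using lost[of y] rB[OF that] by linarith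
        have "\<bar>trunc n0 y\<bar> \<le> B" using trunc[of n0 y] neg(2)[of y] rB[OF that] by linarith
        then show "\<bar>\<delta> / T * trunc n0 y\<bar> \<le> \<delta> / T * B"
          unfolding abs_mult using \<delta>0 T by (intro mult_mono) auto
      qed
      finally show ?thesis by (simp add: algebra_simps)
    qed
    then show "\<exists>r>0. \<exists>B. \<forall>y\<in>ball p r. \<bar>\<mu> y\<bar> \<le> B" using r by blast
    have pS: "p \<in> sphere 0 1" "p \<in> cball 0 1" "p \<in> \<Gamma>" using p K by auto
    have i1: "integrable ?S (\<lambda>y. \<rho> y * neumann_green p y)"
      by (rule green_potential_locally_bounded(1)[OF \<rho> suppS pS(1) r rB])
    have i2: "integrable ?S (\<lambda>y. lost y * neumann_green p y)"
    proof (rule green_potential_locally_bounded(1)[OF ilost _ pS(1) r])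
      show "lost y = 0" if "y \<notin> sphere 0 1" for y
        using suppS[OF that] by (simp add: lost_def trunc_def neg_def)
      show "\<bar>lost y\<bar> \<le> B" if "y \<in> ball p r" for y using lost[of y] rB[OF that] by linarith
    qed
    have "green_potential \<mu> p = (\<integral>y. \<rho> y * neumann_green p y + lost y * neumann_green p y
        - \<delta> / T * (trunc n0 y * neumann_green p y) \<partial>?S)"
      unfolding green_potential_def \<mu>_def by (simp add: algebra_simps)
    also have "\<dots> = green_potential \<rho> p + green_potential lost p - \<delta> / T * green_potential (trunc n0) p"
      unfolding green_potential_def using i1 i2 tau(1)[OF pS(2)] by simp
    also have "green_potential \<rho> p = 1" by (rule eq[OF pS(3)])
    finally have "green_potential \<mu> p = 1 + green_potential lost p - \<delta> / T * green_potential (trunc n0) p" .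
    moreover have "0 \<le> green_potential lost p"
      unfolding green_potential_def
    proof (rule integral_nonneg_AE, rule AE_I2)
      fix y show "0 \<le> lost y * neumann_green p y"
      proof (cases "y \<in> sphere 0 1")
        case True
        then show ?thesis using neumann_green_bounds(1)[of p y] pS lost(1) by simp
      next
        case False
        then show ?thesis using suppS[of y] by (simp add: lost_def trunc_def neg_def)
      qed
    qed
    moreover have "\<delta> / T * green_potential (trunc n0) p \<le> \<delta> / T * M"
      using tau(2)[OF pS(2)] \<delta>0 T by (intro mult_left_mono) auto
    ultimately show "1 / 2 \<le> green_potential \<mu> p" using \<delta>M by linarith
  qed
  then show False by simp
qed

section \<open>The mixed boundary value problem\<close>

lemma continuous_on_arc_dist: "p \<in> sphere 0 1 \<Longrightarrow> continuous_on (sphere 0 1) (arc_dist p)"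
  unfolding arc_dist_def
proof (intro continuous_intros ballI)
  fix x :: "real^3" assume "p \<in> sphere 0 1" "x \<in> sphere 0 1"
  then have "\<bar>p \<bullet> x\<bar> \<le> 1" using Cauchy_Schwarz_ineq2[of p x] by simp
  then show "- 1 \<le> p \<bullet> x \<and> p \<bullet> x \<le> 1" by auto
qed

theorem lemma2:
  fixes N :: nat and \<epsilon> :: real and c :: "nat \<Rightarrow> real^3" and \<sigma> :: "real^3 \<Rightarrow> real"
    and \<Gamma>\<^sub>A \<Gamma>\<^sub>R B\<^sub>A :: "(real^3) set" and v :: "real^3 \<Rightarrow> real" and I\<^sub>\<sigma> D :: real
  assumes "N \<ge> 1" and "\<epsilon> > 0"
    and centers: "\<And>i. i < N \<Longrightarrow> c i \<in> sphere 0 1"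
    and separated: "\<And>i j. i < N \<Longrightarrow> j < N \<Longrightarrow> i \<noteq> j \<Longrightarrow> arc_dist (c i) (c j) \<ge> 3 * \<epsilon>"
    and absorbing: "\<Gamma>\<^sub>A = (\<Union>i<N. geodesic_disk (c i) \<epsilon>)"
    and partial_cover: "sphere 0 1 - closure \<Gamma>\<^sub>A \<noteq> {}"
    and reflecting: "\<Gamma>\<^sub>R = sphere 0 1 - \<Gamma>\<^sub>A"
    and interface: "B\<^sub>A = (\<Union>i<N. geodesic_circle (c i) \<epsilon>)"
    and cont: "continuous_on \<Gamma>\<^sub>A \<sigma>"
    and integrable: "set_integrable sphere_measure \<Gamma>\<^sub>A \<sigma>"
    and integral_equation: "\<And>x. x \<in> \<Gamma>\<^sub>A \<Longrightarrow>
          (LINT x':\<Gamma>\<^sub>A|sphere_measure. neumann_green x x' * \<sigma> x') = 1"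
    and v: "v = single_layer \<Gamma>\<^sub>A \<sigma>"
    and I: "I\<^sub>\<sigma> = (LINT x:\<Gamma>\<^sub>A|sphere_measure. \<sigma> x)"
    and D: "D = - I\<^sub>\<sigma>"
  shows "I\<^sub>\<sigma> \<noteq> 0 \<and>
    C2_on v (ball 0 1) \<and>
    (\<forall>x\<in>ball 0 1. laplacian v x = 0) \<and>
    (\<forall>x\<in>\<Gamma>\<^sub>A. has_boundary_value v 1 x) \<and>
    (\<forall>x\<in>\<Gamma>\<^sub>R - B\<^sub>A. has_normal_derivative v D x)"
proof -
  define \<rho> where "\<rho> y = indicator \<Gamma>\<^sub>A y * \<sigma> y" for y
  have \<rho>: "integrable sphere_measure \<rho>"
    using integrable by (simp add: set_integrable_def \<rho>_def[abs_def])
  have supp: "\<rho> y = 0" if "y \<notin> \<Gamma>\<^sub>A" for y using that by (simp add: \<rho>_def)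
  have \<Gamma>S: "\<Gamma>\<^sub>A \<subseteq> sphere 0 1" unfolding absorbing geodesic_disk_def by auto
  then have suppS: "\<rho> y = 0" if "y \<notin> sphere 0 1" for y using that supp by blast
  have pot: "(LINT x':\<Gamma>\<^sub>A|sphere_measure. neumann_green x x' * \<sigma> x') = green_potential \<rho> x" for x
    by (simp add: set_lebesgue_integral_def green_potential_def \<rho>_def mult_ac)
  then have v\<rho>: "v = green_potential \<rho>" unfolding v single_layer_def[abs_def] by simp
  have I\<rho>: "I\<^sub>\<sigma> = (\<integral>y. \<rho> y \<partial>sphere_measure)"
    unfolding I set_lebesgue_integral_def by (simp add: \<rho>_def)
  have eq: "green_potential \<rho> x = 1" if "x \<in> \<Gamma>\<^sub>A" for x
    using integral_equation[OF that] by (simp add: pot)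
  have "openin (top_of_set (sphere 0 1)) (geodesic_disk (c i) \<epsilon>)" if "i < N" for i
  proof -
    have "geodesic_disk (c i) \<epsilon> = sphere 0 1 \<inter> arc_dist (c i) -` {..<\<epsilon>}"
      by (auto simp: geodesic_disk_def)
    then show ?thesis
      using continuous_openin_preimage_gen[OF continuous_on_arc_dist[OF centers[OF that]], of "{..<\<epsilon>}"] by simp
  qed
  then have "openin (top_of_set (sphere 0 1)) \<Gamma>\<^sub>A" unfolding absorbing by (intro openin_Union) auto
  then obtain Q where Q: "open Q" "\<Gamma>\<^sub>A = sphere 0 1 \<inter> Q" unfolding openin_open by auto
  have "arc_dist (c 0) (c 0) = 0"
    using centers[of 0] \<open>N \<ge> 1\<close> by (simp add: arc_dist_def dot_square_norm)
  then have "c 0 \<in> \<Gamma>\<^sub>A"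
    using centers[of 0] \<open>N \<ge> 1\<close> \<open>\<epsilon> > 0\<close> unfolding absorbing geodesic_disk_def
    by (intro UN_I[of 0]) auto
  then have ne: "\<Gamma>\<^sub>A \<noteq> {}" by auto
  have bounded: "\<exists>r>0. \<exists>B. \<forall>y\<in>ball p r. \<bar>\<rho> y\<bar> \<le> B" if p: "p \<in> \<Gamma>\<^sub>A" for p
  proof -
    obtain r where r: "r > 0" "\<And>y. y \<in> \<Gamma>\<^sub>A \<Longrightarrow> dist y p < r \<Longrightarrow> dist (\<sigma> y) (\<sigma> p) < 1"
      using cont p unfolding continuous_on_iff by (metis zero_less_one)
    have "\<bar>\<rho> y\<bar> \<le> \<bar>\<sigma> p\<bar> + 1" if y: "y \<in> ball p r" for y
    proof (cases "y \<in> \<Gamma>\<^sub>A")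
      case True
      then have "\<bar>\<sigma> y - \<sigma> p\<bar> < 1" using r(2)[of y] y by (simp add: dist_commute dist_real_def)
      then show ?thesis using True by (simp add: \<rho>_def)
    qed (simp add: \<rho>_def)
    then show ?thesis using r(1) by blast
  qed
  note harm = harmonic_green_potential[OF \<rho> suppS]
  have "I\<^sub>\<sigma> \<noteq> 0"
    unfolding I\<rho> by (rule total_charge_nonzero[OF Q ne \<rho> supp bounded eq])
  moreover have "C2_on v (ball 0 1)" "\<forall>x\<in>ball 0 1. laplacian v x = 0"
    unfolding v\<rho> using harmonic_with_gradient_imp[OF harm open_ball] by auto
  moreover have "has_boundary_value v 1 x" if x: "x \<in> \<Gamma>\<^sub>A" for x
  proof -
    obtain r B where "r > 0" "\<And>y. y \<in> ball x r \<Longrightarrow> \<bar>\<rho> y\<bar> \<le> B" using bounded[OF x] by blast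
    from green_potential_locally_bounded(2)[OF \<rho> suppS _ this, of x]
    have "(v \<longlongrightarrow> 1) (at x within cball 0 1)" using x \<Gamma>S eq[OF x] by (auto simp: v\<rho>)
    then show ?thesis
      unfolding has_boundary_value_def by (rule tendsto_within_subset) auto
  qed
  moreover have "has_normal_derivative v D x" if x: "x \<in> \<Gamma>\<^sub>R - B\<^sub>A" for x
  proof -
    \<comment> \<open>The closed patches carry the charge, and \<open>x\<close> lies off them.\<close>
    define K where "K = (\<Union>i<N. sphere 0 1 \<inter> arc_dist (c i) -` {..\<epsilon>})"
    have "compact (sphere 0 1 \<inter> arc_dist (c i) -` {..\<epsilon>})" if "i < N" for i
      by (rule closedin_compact[OF compact_sphere continuous_closedin_preimage[OF
              continuous_on_arc_dist[OF centers[OF that]] closed_atMost]])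
    then have K: "compact K" unfolding K_def by (intro compact_UN) auto
    have KS: "K \<subseteq> sphere 0 1" unfolding K_def by auto
    have "\<Gamma>\<^sub>A \<subseteq> K" unfolding absorbing geodesic_disk_def K_def by force
    then have suppK: "\<rho> y = 0" if "y \<notin> K" for y using that supp by blast
    have xS: "norm x = 1" using x unfolding reflecting by auto
    have "\<not> arc_dist (c i) x < \<epsilon>" "arc_dist (c i) x \<noteq> \<epsilon>" if "i < N" for i
      using x that xS unfolding reflecting absorbing interface geodesic_disk_def geodesic_circle_def
      by auto
    then have xK: "x \<notin> K" unfolding K_def by force
    then have xD: "x \<in> cball 0 1 - K" using xS by simp
    have "(green_potential_grad \<rho> \<longlongrightarrow> green_potential_grad \<rho> x) (at x within cball 0 1 - K)"
      using continuous_on_green_potential(2)[OF \<rho> K KS suppK] xD unfolding continuous_on_def by blast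
    then have "(green_potential_grad \<rho> \<longlongrightarrow> green_potential_grad \<rho> x) (at x within ball 0 1)"
      by (rule tendsto_within_subset) (use KS in auto)
    then have "((\<lambda>y. green_potential_grad \<rho> y \<bullet> x) \<longlongrightarrow> green_potential_grad \<rho> x \<bullet> x) (at x within ball 0 1)"
      by (intro tendsto_intros)
    also have "green_potential_grad \<rho> x \<bullet> x = D"
      using green_potential_grad_radial[OF \<rho> K KS suppK xD] xS by (simp add: inner_commute D I\<rho>)
    finally have "((\<lambda>y. green_potential_grad \<rho> y \<bullet> x) \<longlongrightarrow> D) (at x within ball 0 1)" .
    moreover have "\<forall>\<^sub>F y in at x within ball 0 1. green_potential_grad \<rho> y \<bullet> x = dir_deriv x v y"
      unfolding eventually_at_filter v\<rho>
      using harmonic_with_gradient_imp(3)[OF harm open_ball] by (intro always_eventually) simp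
    ultimately show ?thesis
      unfolding has_normal_derivative_def by (rule Lim_transform_eventually)
  qed
  ultimately show ?thesis by blast
qed

end
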